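(* Let $A$ be the algebra of complex polynomials, regarded as functions on the closed unit disc $\Delta=\{z\in\mathbb{C}:|z|\le1\}$, with the uniform norm $\|p\|_\infty=\sup_{z\in\Delta}|p(z)|$. For $i\ge1$ let $D_i:A\to\mathbb{C}$ be given by $D_i(p)=p^{(i)}(1)/i!$, so that $D=\{D_1,D_2,\dots\}$ is a higher point derivation of infinite order at the character $p\mapsto p(1)$. Let $\overline{A_D}$ be the completion of the algebra $A$ with respect to the translation-invariant metric determined by $$d'(p,0)=\|p\|_\infty+\sum_{i=1}^\infty\frac{2^{-i}|D_i(p)|}{1+|D_i(p)|}\qquad(p\in A),$$ with the multiplication of $A$ extended by continuity. Then the (Jacobson) radical of the commutative Fréchet algebra $\overline{A_D}$ contains elements that are quasinilpotent but not nilpotent.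
   Context: A Fréchet algebra is an algebra with a complete metrizable locally convex topology that can be defined by an increasing sequence of submultiplicative seminorms. A higher point derivation of infinite order at the character $\phi:p\mapsto p(1)$ is a sequence $(D_i)_{i\ge1}$ of linear functionals on $A$ with $D_s(pq)=\phi(p)D_s(q)+\phi(q)D_s(p)+\sum_{i=1}^{s-1}D_i(p)D_{s-i}(q)$ for all $p,q\in A$ and $s\ge1$. In a commutative Fréchet algebra $B$ whose topology is defined by submultiplicative seminorms $(p_k)$, with $B_k$ the Banach algebra completion of $B/\ker p_k$ and $x_k$ the image of $x$ in $B_k$, an element $x$ is quasinilpotent if $r(x)=\sup_k r_k(x_k)=0$, where $r_k(x_k)$ is the spectral radius of $x_k$ in $B_k$. The Jacobson radical of $B$ is the set of its quasinilpotent elements. *)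

theory Defs
  imports
    "HOL-Analysis.Abstract_Metric_Spaces"
    "HOL-Library.Extended_Nonnegative_Real"
    "HOL-Algebra.Algebraic_Closure_Type"
    "HOL-Algebra.QuotRing"
    "HOL-Algebra.Module"
begin

text \<open>
  Algebras are \<^typ>\<open>('s, 'a) module\<close> records, since the Banach algebras \<open>B\<^sub>k\<close> below depend on a
  seminorm and hence cannot be types.
\<close>

abbreviation complex_field :: "complex ring" where
  "complex_field \<equiv> ring_of_type_algebra"

section \<open>Quotients and completions\<close>

text \<open>\<^const>\<open>FactRing\<close> forgets the scalar multiplication, so it is put back here.\<close>

definition quotient_algebra :: "('s, 'a) module \<Rightarrow> 'a set \<Rightarrow> ('s, 'a set) module" where
  "quotient_algebra M I =
    \<lparr>carrier = carrier (M Quot I), monoid.mult = monoid.mult (M Quot I),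
     one = one (M Quot I), ring.zero = ring.zero (M Quot I), add = add (M Quot I),
     module.smult = (\<lambda>c C. \<Union>x\<in>C. I +>\<^bsub>M\<^esub> (c \<odot>\<^bsub>M\<^esub> x))\<rparr>"

text \<open>
  In the following \<open>d x\<close> is the distance of \<open>x\<close> to zero for a translation-invariant metric; the
  metric itself is \<open>(x, y) \<mapsto> d (x - y)\<close>.
\<close>

definition cauchy_seqs :: "('s, 'a) module \<Rightarrow> ('a \<Rightarrow> real) \<Rightarrow> (nat \<Rightarrow> 'a) set" where
  "cauchy_seqs M d =
    {s. range s \<subseteq> carrier M \<and> (\<forall>e>0. \<exists>N. \<forall>m\<ge>N. \<forall>n\<ge>N. d (s m \<ominus>\<^bsub>M\<^esub> s n) < e)}"

definition null_seqs :: "('s, 'a) module \<Rightarrow> ('a \<Rightarrow> real) \<Rightarrow> (nat \<Rightarrow> 'a) set" where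
  "null_seqs M d = {s. range s \<subseteq> carrier M \<and> (\<lambda>n. d (s n)) \<longlonglongrightarrow> 0}"

definition cauchy_algebra :: "('s, 'a) module \<Rightarrow> ('a \<Rightarrow> real) \<Rightarrow> ('s, nat \<Rightarrow> 'a) module" where
  "cauchy_algebra M d =
    \<lparr>carrier = cauchy_seqs M d, monoid.mult = (\<lambda>s t n. s n \<otimes>\<^bsub>M\<^esub> t n),
     one = (\<lambda>n. \<one>\<^bsub>M\<^esub>), ring.zero = (\<lambda>n. \<zero>\<^bsub>M\<^esub>), add = (\<lambda>s t n. s n \<oplus>\<^bsub>M\<^esub> t n),
     module.smult = (\<lambda>c s n. c \<odot>\<^bsub>M\<^esub> s n)\<rparr>"

definition completion :: "('s, 'a) module \<Rightarrow> ('a \<Rightarrow> real) \<Rightarrow> ('s, (nat \<Rightarrow> 'a) set) module" where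
  "completion M d = quotient_algebra (cauchy_algebra M d) (null_seqs M d)"

definition completion_embed :: "('s, 'a) module \<Rightarrow> ('a \<Rightarrow> real) \<Rightarrow> 'a \<Rightarrow> (nat \<Rightarrow> 'a) set" where
  "completion_embed M d x = null_seqs M d +>\<^bsub>cauchy_algebra M d\<^esub> (\<lambda>n. x)"

text \<open>The value 0 off the carrier is what the locale \<^locale>\<open>Metric_space\<close> needs.\<close>

definition completion_metric ::
    "('s, 'a) module \<Rightarrow> ('a \<Rightarrow> real) \<Rightarrow> (nat \<Rightarrow> 'a) set \<Rightarrow> (nat \<Rightarrow> 'a) set \<Rightarrow> real" where
  "completion_metric M d C E =
    (if C \<in> carrier (completion M d) \<and> E \<in> carrier (completion M d)
     then THE l. \<forall>s\<in>C. \<forall>t\<in>E. (\<lambda>n. d (s n \<ominus>\<^bsub>M\<^esub> t n)) \<longlonglongrightarrow> l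
     else 0)"

definition completion_topology ::
    "('s, 'a) module \<Rightarrow> ('a \<Rightarrow> real) \<Rightarrow> (nat \<Rightarrow> 'a) set topology" where
  "completion_topology M d =
    Metric_space.mtopology (carrier (completion M d)) (completion_metric M d)"

section \<open>Frechet algebras\<close>

definition submultiplicative_seminorm :: "(complex, 'a) module \<Rightarrow> ('a \<Rightarrow> real) \<Rightarrow> bool" where
  "submultiplicative_seminorm M p \<longleftrightarrow>
    (\<forall>x\<in>carrier M. 0 \<le> p x) \<and>
    (\<forall>c. \<forall>x\<in>carrier M. p (c \<odot>\<^bsub>M\<^esub> x) = cmod c * p x) \<and>
    (\<forall>x\<in>carrier M. \<forall>y\<in>carrier M. p (x \<oplus>\<^bsub>M\<^esub> y) \<le> p x + p y) \<and>
    (\<forall>x\<in>carrier M. \<forall>y\<in>carrier M. p (x \<otimes>\<^bsub>M\<^esub> y) \<le> p x * p y)"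

definition seminorm_topology :: "('s, 'a) module \<Rightarrow> (nat \<Rightarrow> 'a \<Rightarrow> real) \<Rightarrow> 'a topology" where
  "seminorm_topology M P = topology (\<lambda>U. U \<subseteq> carrier M \<and>
    (\<forall>x\<in>U. \<exists>k. \<exists>e>0. {y \<in> carrier M. \<forall>j\<le>k. P j (y \<ominus>\<^bsub>M\<^esub> x) < e} \<subseteq> U))"

text \<open>\<open>B\<close> with topology \<open>T\<close> is a commutative unital Frechet algebra, and \<open>P\<close> is one of the many
  sequences of seminorms that define \<open>T\<close>.\<close>

definition frechet_algebra ::
    "(complex, 'a) module \<Rightarrow> 'a topology \<Rightarrow> (nat \<Rightarrow> 'a \<Rightarrow> real) \<Rightarrow> bool" where
  "frechet_algebra B T P \<longleftrightarrow>
    Module.algebra complex_field B \<and>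
    (\<forall>k. submultiplicative_seminorm B (P k)) \<and>
    (\<forall>k. \<forall>x\<in>carrier B. P k x \<le> P (Suc k) x) \<and>
    T = seminorm_topology B P \<and>
    completely_metrizable_space T"

section \<open>Quasinilpotent and nilpotent elements, the radical\<close>

definition seminorm_kernel :: "('s, 'a) module \<Rightarrow> ('a \<Rightarrow> real) \<Rightarrow> 'a set" where
  "seminorm_kernel B p = {x \<in> carrier B. p x = 0}"

definition quotient_norm :: "('a \<Rightarrow> real) \<Rightarrow> 'a set \<Rightarrow> real" where
  "quotient_norm p C = (INF x\<in>C. p x)"

definition banach_quotient ::
    "('s, 'a) module \<Rightarrow> ('a \<Rightarrow> real) \<Rightarrow> ('s, (nat \<Rightarrow> 'a set) set) module" where
  "banach_quotient B p =
    completion (quotient_algebra B (seminorm_kernel B p)) (quotient_norm p)"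

definition banach_quotient_image ::
    "('s, 'a) module \<Rightarrow> ('a \<Rightarrow> real) \<Rightarrow> 'a \<Rightarrow> (nat \<Rightarrow> 'a set) set" where
  "banach_quotient_image B p x =
    completion_embed (quotient_algebra B (seminorm_kernel B p)) (quotient_norm p)
      (seminorm_kernel B p +>\<^bsub>B\<^esub> x)"

definition spectrum :: "(complex, 'a) module \<Rightarrow> 'a \<Rightarrow> complex set" where
  "spectrum B x = {c. (c \<odot>\<^bsub>B\<^esub> \<one>\<^bsub>B\<^esub>) \<ominus>\<^bsub>B\<^esub> x \<notin> Units B}"

text \<open>
  The values are in \<^typ>\<open>ennreal\<close>: \<open>sup\<^sub>k r\<^sub>k(x\<^sub>k)\<close> may be infinite, and the spectrum is empty
  (with supremum 0) when \<open>B\<^sub>k\<close> is the zero ring, that is when \<open>p\<^sub>k = 0\<close>.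
\<close>

definition spectral_radius :: "(complex, 'a) module \<Rightarrow> 'a \<Rightarrow> ennreal" where
  "spectral_radius B x = (SUP c\<in>spectrum B x. ennreal (cmod c))"

definition quasinilpotent ::
    "(complex, 'a) module \<Rightarrow> (nat \<Rightarrow> 'a \<Rightarrow> real) \<Rightarrow> 'a \<Rightarrow> bool" where
  "quasinilpotent B P x \<longleftrightarrow> x \<in> carrier B \<and>
    (SUP k. spectral_radius (banach_quotient B (P k)) (banach_quotient_image B (P k) x)) = 0"

definition nilpotent :: "('s, 'a) module \<Rightarrow> 'a \<Rightarrow> bool" where
  "nilpotent B x \<longleftrightarrow> x \<in> carrier B \<and> (\<exists>n::nat. x [^]\<^bsub>B\<^esub> n = \<zero>\<^bsub>B\<^esub>)"

text \<open>
  For commutative unital rings. In a commutative Frechet algebra this is the set of quasinilpotent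
  elements; that is a theorem and is not built into the definition.
\<close>

definition jacobson_radical :: "('s, 'a) module \<Rightarrow> 'a set" where
  "jacobson_radical B = {x \<in> carrier B. \<forall>J. maximalideal J B \<longrightarrow> x \<in> J}"

section \<open>Higher point derivations of infinite order\<close>

definition linear_functional :: "(complex, 'a) module \<Rightarrow> ('a \<Rightarrow> complex) \<Rightarrow> bool" where
  "linear_functional A f \<longleftrightarrow>
    (\<forall>p\<in>carrier A. \<forall>q\<in>carrier A. f (p \<oplus>\<^bsub>A\<^esub> q) = f p + f q) \<and>
    (\<forall>c. \<forall>p\<in>carrier A. f (c \<odot>\<^bsub>A\<^esub> p) = c * f p)"

definition algebra_character :: "(complex, 'a) module \<Rightarrow> ('a \<Rightarrow> complex) \<Rightarrow> bool" where
  "algebra_character A \<phi> \<longleftrightarrow> linear_functional A \<phi> \<and> \<phi> \<in> ring_hom A complex_field"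

text \<open>The sequence is indexed from 1; the value \<open>D 0\<close> plays no role.\<close>

definition higher_point_derivation ::
    "(complex, 'a) module \<Rightarrow> ('a \<Rightarrow> complex) \<Rightarrow> (nat \<Rightarrow> 'a \<Rightarrow> complex) \<Rightarrow> bool" where
  "higher_point_derivation A \<phi> D \<longleftrightarrow>
    algebra_character A \<phi> \<and>
    (\<forall>i\<ge>1. linear_functional A (D i)) \<and>
    (\<forall>s\<ge>1. \<forall>p\<in>carrier A. \<forall>q\<in>carrier A.
      D s (p \<otimes>\<^bsub>A\<^esub> q) =
        \<phi> p * D s q + \<phi> q * D s p + (\<Sum>i = 1..s - 1. D i p * D (s - i) q))"

section \<open>The polynomial algebra on the disc and its completion\<close>

text \<open>A complex polynomial is determined by its values on the disc, so the algebra of polynomial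
  functions is represented by \<^typ>\<open>complex poly\<close>.\<close>

definition poly_algebra :: "(complex, complex poly) module" where
  "poly_algebra =
    \<lparr>carrier = UNIV, monoid.mult = (*), one = 1, ring.zero = 0, add = (+),
     module.smult = Polynomial.smult\<rparr>"

definition disc_norm :: "complex poly \<Rightarrow> real" where
  "disc_norm p = (SUP z\<in>cball 0 1. cmod (poly p z))"

definition taylor_functional :: "nat \<Rightarrow> complex poly \<Rightarrow> complex" where
  "taylor_functional i p = poly ((pderiv ^^ i) p) 1 / fact i"

definition derivation_length :: "(nat \<Rightarrow> complex poly \<Rightarrow> complex) \<Rightarrow> complex poly \<Rightarrow> real" where
  "derivation_length D p =
    disc_norm p + (\<Sum>i. (1 / 2) ^ Suc i * cmod (D (Suc i) p) / (1 + cmod (D (Suc i) p)))"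

abbreviation A_D :: "(complex, (nat \<Rightarrow> complex poly) set) module" where
  "A_D \<equiv> completion poly_algebra (derivation_length taylor_functional)"

abbreviation A_D_topology :: "(nat \<Rightarrow> complex poly) set topology" where
  "A_D_topology \<equiv> completion_topology poly_algebra (derivation_length taylor_functional)"

end

theory Submission
  imports Defs
begin

text \<open>
  The seminorms \<open>\<parallel>p\<parallel>\<^sub>\<infinity> + \<Sum>\<^sub>i\<^sub>\<le>\<^sub>k \<bar>D\<^sub>i p\<bar>\<close> are submultiplicative and define the
  topology of \<open>d'\<close>. If polynomials \<open>s\<^sub>n\<close> converge in the completion while \<open>\<parallel>s\<^sub>n\<parallel>\<^sub>\<infinity>\<close> tends to 0,
  then their limit \<open>x\<close> has, up to a null sequence, only Taylor coefficients of positive order, so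
  \<open>\<Sum>\<^sub>j x\<^sup>j\<close> converges and \<open>1 - x\<close> is invertible. Such limits form an ideal, which therefore
  lies in the radical; and as every \<open>c - x\<close> with \<open>c \<noteq> 0\<close> is invertible, so is its image in each
  Banach algebra \<open>B\<^sub>k\<close>, whatever the defining seminorms. A limit of this kind with Taylor series
  \<open>log z\<close> at 1 comes from truncating the series of \<open>log (z\<^sup>m) / m\<close> with \<open>m\<close> growing fast. Its
  \<open>n\<close>-th power has \<open>n\<close>-th Taylor coefficient 1, so it is not nilpotent.
\<close>

section \<open>Quotient algebras\<close>

text \<open>At the boundary point 1 the uniform norm controls the value of a polynomial but none of
  its derivatives: z^m has norm 1 and first Taylor coefficient m. The completion therefore keeps
  Taylor data that the uniform limit has lost, and this is where elements with uniform limit 0 and a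
  nonzero Taylor series can live. The logarithm is suited to producing one because log (z^m) / m =
  log z: the exponent m is a free parameter that does not change the Taylor series at 1, while z^m -
  1 is bounded by 2 on the disc for every m, so the factor 1/m can make a truncated series uniformly
  small.

  Two kinds of completion occur: that of the polynomials for a metric that is not homogeneous, and
  the algebras B_k of an arbitrary seminorm. Both are instances of one construction, in which a
  metric and an increasing sequence of submultiplicative seminorms are linked only by having the
  same small neighbourhoods of zero.\<close>

context
  fixes M :: "('s, 'a) module" (structure) and I :: "'a set"
  assumes I: "ideal I M"
begin

interpretation ideal I M by (rule I)

lemma carrier_quotient_algebra: "carrier (quotient_algebra M I) = (+>) I ` carrier M"
  by (auto simp: quotient_algebra_def FactRing_simps)

lemma quotient_algebra_add:
  assumes "x \<in> carrier M" "y \<in> carrier M"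
  shows "(I +> x) \<oplus>\<^bsub>quotient_algebra M I\<^esub> (I +> y) = I +> (x \<oplus> y)"
  using assms by (simp add: quotient_algebra_def FactRing_def a_rcos_sum)

lemma quotient_algebra_mult:
  assumes "x \<in> carrier M" "y \<in> carrier M"
  shows "(I +> x) \<otimes>\<^bsub>quotient_algebra M I\<^esub> (I +> y) = I +> (x \<otimes> y)"
  using assms by (simp add: quotient_algebra_def FactRing_def rcoset_mult_add)

lemma quotient_algebra_one: "\<one>\<^bsub>quotient_algebra M I\<^esub> = I +> \<one>"
  by (simp add: quotient_algebra_def FactRing_def)

lemma quotient_algebra_zero: "\<zero>\<^bsub>quotient_algebra M I\<^esub> = I +> \<zero>"
  by (simp add: quotient_algebra_def FactRing_def a_rcos_zero[OF I additive_subgroup.zero_closed[OF additive_subgroup_axioms]])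

text \<open>The scalar multiple of a coset is defined as a union over all representatives, so it
  must be seen that they all give the same coset. Here \<open>c\<close> acts as multiplication by
  the ring element \<open>c\<close> times one, hence the ring ideal \<open>I\<close> is closed under
  scalars as well.\<close>

lemma quotient_algebra_smult:
  assumes "Module.algebra K M" "c \<in> carrier K" "x \<in> carrier M"
  shows "c \<odot>\<^bsub>quotient_algebra M I\<^esub> (I +> x) = I +> (c \<odot> x)"
proof -
  interpret A: Module.algebra K M by fact
  have *: "I +> (c \<odot> y) = I +> (c \<odot> x)" if y: "y \<in> I +> x" for y
  proof -
    obtain h where h: "h \<in> I" "y = h \<oplus> x"
      using y by (auto simp: a_r_coset_def r_coset_def)
    have hc: "h \<in> carrier M" using h a_subset by auto
    have "c \<odot> h = (c \<odot> \<one>) \<otimes> h"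
      using A.smult_assoc2[of c \<one> h] hc assms by simp
    then have "c \<odot> h \<in> I" using h assms by (simp add: I_l_closed)
    moreover have "c \<odot> y = c \<odot> h \<oplus> c \<odot> x"
      using h hc assms by (simp add: A.smult_r_distr)
    ultimately have "c \<odot> y \<in> I +> (c \<odot> x)"
      by (auto simp: a_r_coset_def r_coset_def)
    then show ?thesis
      using assms a_repr_independence' by (metis A.smult_closed)
  qed
  have "x \<in> I +> x" using assms a_rcos_self by auto
  then have "(\<Union>y\<in>I +> x. I +> (c \<odot> y)) = I +> (c \<odot> x)" using * by blast
  then show ?thesis by (simp add: quotient_algebra_def)
qed

lemma quotient_algebra_algebra:
  assumes "Module.algebra K M"
  shows "Module.algebra K (quotient_algebra M I)"
proof -
  interpret A: Module.algebra K M by fact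
  note simps = quotient_algebra_add quotient_algebra_mult quotient_algebra_one
    quotient_algebra_zero quotient_algebra_smult[OF assms]
  show ?thesis
  proof (rule algebraI)
    show "cring (quotient_algebra M I)"
    proof (rule cringI)
      show "abelian_group (quotient_algebra M I)"
      proof (rule abelian_groupI)
        fix C assume "C \<in> carrier (quotient_algebra M I)"
        then obtain x where x: "x \<in> carrier M" "C = I +> x"
          by (auto simp: carrier_quotient_algebra)
        show "\<exists>Y\<in>carrier (quotient_algebra M I).
            Y \<oplus>\<^bsub>quotient_algebra M I\<^esub> C = \<zero>\<^bsub>quotient_algebra M I\<^esub>"
          using x by (intro bexI[of _ "I +> \<ominus> x"]) (auto simp: simps l_neg carrier_quotient_algebra)
      qed (auto simp: carrier_quotient_algebra simps a_ac)
      show "comm_monoid (quotient_algebra M I)"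
        by (rule comm_monoidI) (auto simp: carrier_quotient_algebra simps A.m_ac)
    qed (auto simp: carrier_quotient_algebra simps l_distr)
  qed (auto simp: carrier_quotient_algebra simps A.R_cring A.smult_l_distr A.smult_r_distr
        A.smult_assoc1 A.smult_assoc2)
qed

lemma quotient_algebra_uminus:
  assumes "Module.algebra K M" "x \<in> carrier M"
  shows "\<ominus>\<^bsub>quotient_algebra M I\<^esub> (I +> x) = I +> \<ominus> x"
proof -
  interpret Q: Module.algebra K "quotient_algebra M I"
    by (rule quotient_algebra_algebra[OF assms(1)])
  show ?thesis
    using assms
    by (intro Q.minus_equality)
      (auto simp: carrier_quotient_algebra quotient_algebra_add quotient_algebra_zero l_neg)
qed

lemma quotient_algebra_minus:
  assumes "Module.algebra K M" "x \<in> carrier M" "y \<in> carrier M"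
  shows "(I +> x) \<ominus>\<^bsub>quotient_algebra M I\<^esub> (I +> y) = I +> (x \<ominus> y)"
  using assms by (simp add: a_minus_def quotient_algebra_uminus[OF assms(1)] quotient_algebra_add)

lemma coset_eq_iff:
  assumes "x \<in> carrier M" "y \<in> carrier M"
  shows "I +> x = I +> y \<longleftrightarrow> x \<ominus> y \<in> I"
  by (metis a_rcos_module_minus a_rcos_self a_repr_independence' assms ring_axioms)

end


section \<open>Submultiplicative seminorms\<close>

lemma complex_field_simps [simp]:
  "carrier complex_field = UNIV" "\<one>\<^bsub>complex_field\<^esub> = 1" "\<zero>\<^bsub>complex_field\<^esub> = 0"
  "a \<oplus>\<^bsub>complex_field\<^esub> b = a + b" "a \<otimes>\<^bsub>complex_field\<^esub> b = a * b"
  by (simp_all add: ring_of_type_algebra_def)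

lemma smult_minus_one:
  fixes M :: "(complex, 'a) module" (structure)
  assumes "Module.algebra complex_field M" and x: "x \<in> carrier M"
  shows "(- 1 :: complex) \<odot> x = \<ominus> x"
proof -
  interpret Module.algebra complex_field M by fact
  have "(- 1 :: complex) \<odot> x \<oplus> 1 \<odot> x = (- 1 + 1 :: complex) \<odot> x"
    using smult_l_distr[of "-1" 1 x] x by simp
  also have "\<dots> = \<zero>" using smult_l_null[of x] x by simp
  finally have "(- 1 :: complex) \<odot> x \<oplus> x = \<zero>"
    using smult_one[of x] x by simp
  then show ?thesis
    using minus_equality[of "(- 1 :: complex) \<odot> x" x] x by simp
qed

context
  fixes M :: "(complex, 'a) module" (structure) and p :: "'a \<Rightarrow> real"
  assumes alg: "Module.algebra complex_field M" and p: "submultiplicative_seminorm M p"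
begin

interpretation Module.algebra complex_field M by (rule alg)

lemma seminorm_nonneg: "x \<in> carrier M \<Longrightarrow> 0 \<le> p x"
  and seminorm_smult: "x \<in> carrier M \<Longrightarrow> p (c \<odot> x) = cmod c * p x"
  and seminorm_add: "x \<in> carrier M \<Longrightarrow> y \<in> carrier M \<Longrightarrow> p (x \<oplus> y) \<le> p x + p y"
  and seminorm_mult: "x \<in> carrier M \<Longrightarrow> y \<in> carrier M \<Longrightarrow> p (x \<otimes> y) \<le> p x * p y"
  using p by (auto simp: submultiplicative_seminorm_def)

lemma seminorm_zero: "p \<zero> = 0"
  using seminorm_smult[of \<zero> 0] smult_l_null[of \<zero>] by simp

lemma seminorm_uminus: "x \<in> carrier M \<Longrightarrow> p (\<ominus> x) = p x"
  using seminorm_smult[of x "-1"] by (simp add: smult_minus_one[OF alg])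

lemma seminorm_minus:
  assumes "x \<in> carrier M" "y \<in> carrier M"
  shows "p (x \<ominus> y) \<le> p x + p y"
  using seminorm_add[of x "\<ominus> y"] seminorm_uminus[of y] assms by (simp add: a_minus_def)

lemma seminorm_minus_commute:
  assumes "x \<in> carrier M" "y \<in> carrier M"
  shows "p (x \<ominus> y) = p (y \<ominus> x)"
proof -
  have "y \<ominus> x = \<ominus> (x \<ominus> y)" using assms by algebra
  then show ?thesis using seminorm_uminus[of "x \<ominus> y"] assms by simp
qed

lemma seminorm_diff:
  assumes "x \<in> carrier M" "y \<in> carrier M"
  shows "\<bar>p x - p y\<bar> \<le> p (x \<ominus> y)"
proof -
  have "x = (x \<ominus> y) \<oplus> y" "y = (y \<ominus> x) \<oplus> x" using assms by algebra+
  then have "p x \<le> p (x \<ominus> y) + p y" "p y \<le> p (y \<ominus> x) + p x"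
    using seminorm_add assms by (metis minus_closed)+
  then show ?thesis using seminorm_minus_commute[OF assms] by linarith
qed

lemma seminorm_kernel_ideal: "ideal (seminorm_kernel M p) M"
proof -
  have mult: "p (x \<otimes> y) = 0" if "x \<in> carrier M" "y \<in> carrier M" "p x = 0 \<or> p y = 0" for x y
    using seminorm_mult[of x y] seminorm_nonneg[of "x \<otimes> y"] that by auto
  have add: "p (x \<oplus> y) = 0" if "x \<in> carrier M" "y \<in> carrier M" "p x = 0" "p y = 0" for x y
    using seminorm_add[of x y] seminorm_nonneg[of "x \<oplus> y"] that by auto
  show ?thesis
  proof (rule idealI)
    show "subgroup (seminorm_kernel M p) (add_monoid M)"
      by (rule add.subgroupI)
        (use add in \<open>auto simp: seminorm_kernel_def seminorm_zero seminorm_uminus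
            a_inv_def[symmetric] intro: exI[of _ \<zero>]\<close>)
  qed (use mult in \<open>auto simp: seminorm_kernel_def ring_axioms\<close>)
qed

text \<open>By the reverse triangle inequality \<open>p\<close> is constant on each coset of its
  kernel, so the infimum is taken over a single value.\<close>

lemma quotient_norm_coset:
  assumes "x \<in> carrier M"
  shows "quotient_norm p (seminorm_kernel M p +> x) = p x"
proof -
  interpret K: ideal "seminorm_kernel M p" M by (rule seminorm_kernel_ideal)
  have *: "p y = p x" if y: "y \<in> seminorm_kernel M p +> x" for y
  proof -
    obtain h where h: "h \<in> carrier M" "p h = 0" "y = h \<oplus> x"
      using y unfolding a_r_coset_def' seminorm_kernel_def by blast
    have "y \<ominus> x = h" unfolding h(3) using h(1) assms by (simp add: a_minus_def M.a_assoc M.r_neg)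
    moreover have "y \<in> carrier M" using h assms by simp
    ultimately show ?thesis using seminorm_diff[of y x] h(2) assms by simp
  qed
  have "x \<in> seminorm_kernel M p +> x" by (rule K.a_rcos_self[OF assms])
  then have ne: "seminorm_kernel M p +> x \<noteq> {}" by blast
  have "(INF y\<in>seminorm_kernel M p +> x. p y) = (INF y\<in>seminorm_kernel M p +> x. p x)"
    by (rule INF_cong[OF refl *])
  also have "\<dots> = p x" by (rule cINF_const[OF ne])
  finally show ?thesis unfolding quotient_norm_def .
qed

lemma submultiplicative_quotient_norm:
  "submultiplicative_seminorm (quotient_algebra M (seminorm_kernel M p)) (quotient_norm p)"
  unfolding submultiplicative_seminorm_def
  by (auto simp: carrier_quotient_algebra[OF seminorm_kernel_ideal] quotient_norm_coset
      quotient_algebra_smult[OF seminorm_kernel_ideal alg]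
      quotient_algebra_add[OF seminorm_kernel_ideal]
      quotient_algebra_mult[OF seminorm_kernel_ideal]
      seminorm_nonneg seminorm_smult seminorm_add seminorm_mult)

end

section \<open>Completions\<close>

abbreviation double_limit :: "(nat \<times> nat) filter" where
  "double_limit \<equiv> sequentially \<times>\<^sub>F sequentially"

lemma tendsto_zero_iff_less:
  fixes f :: "'i \<Rightarrow> real"
  assumes "\<And>i. 0 \<le> f i"
  shows "(f \<longlongrightarrow> 0) F \<longleftrightarrow> (\<forall>e>0. \<forall>\<^sub>F i in F. f i < e)"
  using assms by (simp add: tendsto_iff)

lemma tendsto_zero_le:
  fixes f g :: "'i \<Rightarrow> real"
  assumes "(g \<longlongrightarrow> c) F" "\<And>i. 0 \<le> f i" "\<And>i. f i \<le> g i" "c = 0"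
  shows "(f \<longlongrightarrow> 0) F"
  using assms by (intro Lim_null_comparison[of f g F]) auto

text \<open>A majorant that tends to 0 along pairs of indices makes a sequence Cauchy. This serves
  for the seminorms, the distances and the Taylor coefficients attached to Cauchy sequences.\<close>

lemma Cauchy_double_limit:
  fixes f :: "nat \<Rightarrow> 'b :: banach"
  assumes g: "((\<lambda>i. g (fst i) (snd i)) \<longlongrightarrow> (0::real)) double_limit"
    and le: "\<And>m n. norm (f m - f n) \<le> g m n"
  shows "convergent f"
proof -
  have "Cauchy f"
  proof (rule metric_CauchyI)
    fix e :: real assume "0 < e"
    with g have "\<forall>\<^sub>F i in double_limit. g (fst i) (snd i) < e"
      by (rule order_tendstoD)
    then obtain N where "\<And>m n. m \<ge> N \<Longrightarrow> n \<ge> N \<Longrightarrow> g n m < e"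
      by (auto simp: eventually_prod_sequentially)
    then show "\<exists>N. \<forall>m\<ge>N. \<forall>n\<ge>N. dist (f m) (f n) < e"
      using le by (intro exI[of _ N]) (auto simp: dist_norm intro!: le_less_trans[OF le])
  qed
  then show ?thesis by (rule Cauchy_convergent)
qed

text \<open>The function \<open>d\<close> gives the metric, but it may fail to be homogeneous or
  submultiplicative, so scalars and products are estimated through the seminorms \<open>Q k\<close>.
  The assumptions \<open>Q_small\<close> and \<open>d_small\<close> say that both describe the same
  neighbourhoods of zero.\<close>

locale seminormed_algebra = Module.algebra complex_field M
  for M :: "(complex, 'a) module" (structure) +
  fixes d :: "'a \<Rightarrow> real" and Q :: "nat \<Rightarrow> 'a \<Rightarrow> real"
  assumes Q: "submultiplicative_seminorm M (Q k)"
    and Q_mono: "x \<in> carrier M \<Longrightarrow> Q k x \<le> Q (Suc k) x"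
    and d_nonneg: "x \<in> carrier M \<Longrightarrow> 0 \<le> d x"
    and d_add: "x \<in> carrier M \<Longrightarrow> y \<in> carrier M \<Longrightarrow> d (x \<oplus> y) \<le> d x + d y"
    and d_uminus: "x \<in> carrier M \<Longrightarrow> d (\<ominus> x) = d x"
    and Q_small: "0 < e \<Longrightarrow> \<exists>\<delta>>0. \<forall>x\<in>carrier M. d x < \<delta> \<longrightarrow> Q k x < e"
    and d_small: "0 < e \<Longrightarrow> \<exists>k. \<exists>\<delta>>0. \<forall>x\<in>carrier M. Q k x < \<delta> \<longrightarrow> d x < e"
begin

lemmas Q_nonneg = seminorm_nonneg[OF algebra_axioms Q]
  and Q_smult = seminorm_smult[OF algebra_axioms Q]
  and Q_add = seminorm_add[OF algebra_axioms Q]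
  and Q_mult = seminorm_mult[OF algebra_axioms Q]
  and Q_zero = seminorm_zero[OF algebra_axioms Q]
  and Q_uminus = seminorm_uminus[OF algebra_axioms Q]
  and Q_diff = seminorm_diff[OF algebra_axioms Q]

lemma Q_mono':
  assumes "j \<le> k" "x \<in> carrier M"
  shows "Q j x \<le> Q k x"
  using lift_Suc_mono_le[of "\<lambda>k. Q k x", OF Q_mono[OF assms(2)] assms(1)] .

lemma d_minus_commute:
  assumes "x \<in> carrier M" "y \<in> carrier M"
  shows "d (x \<ominus> y) = d (y \<ominus> x)"
proof -
  have "y \<ominus> x = \<ominus> (x \<ominus> y)"
    using assms by (simp add: a_minus_def M.minus_add M.a_comm)
  then show ?thesis using d_uminus[of "x \<ominus> y"] assms by simp
qed

lemma minus_split: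
  assumes "x \<in> carrier M" "y \<in> carrier M" "z \<in> carrier M"
  shows "x \<ominus> z = (x \<ominus> y) \<oplus> (y \<ominus> z)"
proof -
  have "(x \<ominus> y) \<oplus> (y \<ominus> z) = x \<oplus> ((\<ominus> y \<oplus> y) \<oplus> \<ominus> z)"
    using assms by (simp add: a_minus_def M.a_assoc)
  then show ?thesis using assms by (simp add: M.l_neg a_minus_def)
qed

lemma d_triangle:
  assumes "x \<in> carrier M" "y \<in> carrier M" "z \<in> carrier M"
  shows "d (x \<ominus> z) \<le> d (x \<ominus> y) + d (y \<ominus> z)"
  using d_add[of "x \<ominus> y" "y \<ominus> z"] assms by (simp add: minus_split[of x y z])

text \<open>Stated for an arbitrary filter so that it applies to null sequences along
  \<open>sequentially\<close> and to Cauchy sequences, as families of differences, along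
  \<open>double_limit\<close>.\<close>

lemma tendsto_d_iff:
  assumes a: "\<And>i. a i \<in> carrier M"
  shows "((\<lambda>i. d (a i)) \<longlongrightarrow> 0) F \<longleftrightarrow> (\<forall>k. ((\<lambda>i. Q k (a i)) \<longlongrightarrow> 0) F)"
proof
  assume L: "((\<lambda>i. d (a i)) \<longlongrightarrow> 0) F"
  show "\<forall>k. ((\<lambda>i. Q k (a i)) \<longlongrightarrow> 0) F"
  proof
    fix k
    have "\<forall>\<^sub>F i in F. Q k (a i) < e" if e: "0 < e" for e
    proof -
      obtain \<delta> where \<delta>: "0 < \<delta>" "\<And>x. x \<in> carrier M \<Longrightarrow> d x < \<delta> \<Longrightarrow> Q k x < e"
        using Q_small[OF e] by blast
      have "\<forall>\<^sub>F i in F. d (a i) < \<delta>"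
        using L \<delta>(1) by (rule order_tendstoD)
      then show ?thesis by eventually_elim (rule \<delta>(2)[OF a])
    qed
    then show "((\<lambda>i. Q k (a i)) \<longlongrightarrow> 0) F"
      by (subst tendsto_zero_iff_less) (auto simp: Q_nonneg a)
  qed
next
  assume L: "\<forall>k. ((\<lambda>i. Q k (a i)) \<longlongrightarrow> 0) F"
  have "\<forall>\<^sub>F i in F. d (a i) < e" if e: "0 < e" for e
  proof -
    obtain k \<delta> where \<delta>: "0 < \<delta>" "\<And>x. x \<in> carrier M \<Longrightarrow> Q k x < \<delta> \<Longrightarrow> d x < e"
      using d_small[OF e] by blast
    have "\<forall>\<^sub>F i in F. Q k (a i) < \<delta>"
      using L[rule_format] \<delta>(1) by (rule order_tendstoD)
    then show ?thesis by eventually_elim (rule \<delta>(2)[OF a])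
  qed
  then show "((\<lambda>i. d (a i)) \<longlongrightarrow> 0) F"
    by (subst tendsto_zero_iff_less) (auto simp: d_nonneg a)
qed

lemma cauchy_seqs_iff_d:
  "s \<in> cauchy_seqs M d \<longleftrightarrow>
    (\<forall>n. s n \<in> carrier M) \<and> ((\<lambda>i. d (s (fst i) \<ominus> s (snd i))) \<longlongrightarrow> 0) double_limit"
proof (cases "\<forall>n. s n \<in> carrier M")
  case True
  then have "((\<lambda>i. d (s (fst i) \<ominus> s (snd i))) \<longlongrightarrow> 0) double_limit \<longleftrightarrow>
      (\<forall>e>0. \<exists>N. \<forall>m\<ge>N. \<forall>n\<ge>N. d (s m \<ominus> s n) < e)"
    by (subst tendsto_zero_iff_less)
      (auto simp: d_nonneg eventually_prod_sequentially, (metis d_minus_commute)+)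
  then show ?thesis using True by (auto simp: cauchy_seqs_def)
qed (auto simp: cauchy_seqs_def)

lemma cauchy_seqs_iff:
  "s \<in> cauchy_seqs M d \<longleftrightarrow>
    (\<forall>n. s n \<in> carrier M) \<and> (\<forall>k. ((\<lambda>i. Q k (s (fst i) \<ominus> s (snd i))) \<longlongrightarrow> 0) double_limit)"
proof (cases "\<forall>n. s n \<in> carrier M")
  case True
  then show ?thesis unfolding cauchy_seqs_iff_d by (subst tendsto_d_iff) auto
qed (auto simp: cauchy_seqs_iff_d)

lemma null_seqs_iff:
  "s \<in> null_seqs M d \<longleftrightarrow> (\<forall>n. s n \<in> carrier M) \<and> (\<forall>k. (\<lambda>n. Q k (s n)) \<longlonglongrightarrow> 0)"
proof (cases "\<forall>n. s n \<in> carrier M")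
  case True
  then have "(\<lambda>n. d (s n)) \<longlonglongrightarrow> 0 \<longleftrightarrow> (\<forall>k. (\<lambda>n. Q k (s n)) \<longlonglongrightarrow> 0)"
    by (intro tendsto_d_iff) auto
  then show ?thesis using True by (auto simp: null_seqs_def)
qed (auto simp: null_seqs_def)

lemma cauchy_seqs_carrier: "s \<in> cauchy_seqs M d \<Longrightarrow> s n \<in> carrier M"
  by (simp add: cauchy_seqs_iff)

lemma null_seqs_carrier: "s \<in> null_seqs M d \<Longrightarrow> s n \<in> carrier M"
  by (simp add: null_seqs_iff)

lemma cauchy_convergent_Q:
  assumes "s \<in> cauchy_seqs M d"
  shows "convergent (\<lambda>n. Q k (s n))"
  using assms
  by (intro Cauchy_double_limit[of "\<lambda>m n. Q k (s m \<ominus> s n)"]) (auto simp: cauchy_seqs_iff Q_diff)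

lemma cauchy_bounded_Q:
  assumes "s \<in> cauchy_seqs M d"
  obtains B where "0 \<le> B" "\<And>n. Q k (s n) \<le> B"
proof -
  obtain B where "\<And>n. norm (Q k (s n)) \<le> B"
    using convergent_imp_Bseq[OF cauchy_convergent_Q[OF assms]] by (auto simp: Bseq_def)
  then have B: "Q k (s n) \<le> B" for n by (smt (verit) real_norm_def)
  moreover have "0 \<le> B"
    using B[of 0] Q_nonneg[OF cauchy_seqs_carrier[OF assms], of k 0] by linarith
  ultimately show ?thesis using that by blast
qed

section \<open>The algebra of Cauchy sequences\<close>

lemma cauchy_add:
  assumes s: "s \<in> cauchy_seqs M d" and t: "t \<in> cauchy_seqs M d"
  shows "(\<lambda>n. s n \<oplus> t n) \<in> cauchy_seqs M d"
  unfolding cauchy_seqs_iff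
proof (intro conjI allI)
  note [simp] = cauchy_seqs_carrier[OF s] cauchy_seqs_carrier[OF t]
  show "s n \<oplus> t n \<in> carrier M" for n by simp
  fix k
  have "(s m \<oplus> t m) \<ominus> (s n \<oplus> t n) = (s m \<ominus> s n) \<oplus> (t m \<ominus> t n)" for m n
    by (simp add: a_minus_def M.minus_add M.a_ac)
  then have le: "Q k ((s m \<oplus> t m) \<ominus> (s n \<oplus> t n)) \<le> Q k (s m \<ominus> s n) + Q k (t m \<ominus> t n)" for m n
    by (simp add: Q_add)
  have "((\<lambda>i. Q k (s (fst i) \<ominus> s (snd i)) + Q k (t (fst i) \<ominus> t (snd i))) \<longlongrightarrow> 0 + 0) double_limit"
    using s t by (intro tendsto_add) (auto simp: cauchy_seqs_iff)
  then show "((\<lambda>i. Q k ((s (fst i) \<oplus> t (fst i)) \<ominus> (s (snd i) \<oplus> t (snd i)))) \<longlongrightarrow> 0) double_limit"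
    by (rule tendsto_zero_le) (simp_all add: Q_nonneg le)
qed

lemma mult_minus_split:
  assumes "a \<in> carrier M" "b \<in> carrier M" "a' \<in> carrier M" "b' \<in> carrier M"
  shows "a \<otimes> b \<ominus> a' \<otimes> b' = (a \<ominus> a') \<otimes> b \<oplus> a' \<otimes> (b \<ominus> b')"
proof -
  have "(a \<ominus> a') \<otimes> b = a \<otimes> b \<ominus> a' \<otimes> b" "a' \<otimes> (b \<ominus> b') = a' \<otimes> b \<ominus> a' \<otimes> b'"
    using assms by (simp_all add: a_minus_def l_distr r_distr l_minus r_minus)
  then show ?thesis
    using minus_split[of "a \<otimes> b" "a' \<otimes> b" "a' \<otimes> b'"] assms by simp
qed

lemma cauchy_mult:
  assumes s: "s \<in> cauchy_seqs M d" and t: "t \<in> cauchy_seqs M d"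
  shows "(\<lambda>n. s n \<otimes> t n) \<in> cauchy_seqs M d"
  unfolding cauchy_seqs_iff
proof (intro conjI allI)
  note [simp] = cauchy_seqs_carrier[OF s] cauchy_seqs_carrier[OF t]
  show "s n \<otimes> t n \<in> carrier M" for n by simp
  fix k
  obtain B where B: "0 \<le> B" "\<And>n. Q k (s n) \<le> B" using cauchy_bounded_Q[OF s] by blast
  obtain C where C: "0 \<le> C" "\<And>n. Q k (t n) \<le> C" using cauchy_bounded_Q[OF t] by blast
  have le: "Q k (s m \<otimes> t m \<ominus> s n \<otimes> t n) \<le> Q k (s m \<ominus> s n) * C + B * Q k (t m \<ominus> t n)" for m n
  proof -
    have "Q k (s m \<otimes> t m \<ominus> s n \<otimes> t n) \<le> Q k ((s m \<ominus> s n) \<otimes> t m) + Q k (s n \<otimes> (t m \<ominus> t n))"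
      by (simp add: mult_minus_split Q_add)
    also have "\<dots> \<le> Q k (s m \<ominus> s n) * Q k (t m) + Q k (s n) * Q k (t m \<ominus> t n)"
      by (intro add_mono Q_mult) auto
    also have "\<dots> \<le> Q k (s m \<ominus> s n) * C + B * Q k (t m \<ominus> t n)"
      by (intro add_mono mult_mono B C Q_nonneg order_refl) auto
    finally show ?thesis .
  qed
  have "((\<lambda>i. Q k (s (fst i) \<ominus> s (snd i)) * C + B * Q k (t (fst i) \<ominus> t (snd i))) \<longlongrightarrow> 0 * C + B * 0)
      double_limit"
    using s t by (intro tendsto_intros) (auto simp: cauchy_seqs_iff)
  then show "((\<lambda>i. Q k (s (fst i) \<otimes> t (fst i) \<ominus> s (snd i) \<otimes> t (snd i))) \<longlongrightarrow> 0) double_limit"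
    by (rule tendsto_zero_le) (simp_all add: Q_nonneg le)
qed

lemma cauchy_const: "x \<in> carrier M \<Longrightarrow> (\<lambda>n. x) \<in> cauchy_seqs M d"
  by (simp add: cauchy_seqs_iff a_minus_def M.r_neg Q_zero)

text \<open>Turns scalar multiples into products, so that closure under scalars and under negation
  follows from \<open>cauchy_mult\<close>.\<close>

lemma smult_eq_mult:
  assumes "x \<in> carrier M"
  shows "c \<odot> x = (c \<odot> \<one>) \<otimes> x"
  using smult_assoc2[of c \<one> x] assms by simp

lemma cauchy_smult:
  assumes s: "s \<in> cauchy_seqs M d"
  shows "(\<lambda>n. c \<odot> s n) \<in> cauchy_seqs M d"
proof -
  have "(\<lambda>n. (c \<odot> \<one>) \<otimes> s n) \<in> cauchy_seqs M d"
    by (intro cauchy_mult cauchy_const s) simp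
  moreover have "(c \<odot> \<one>) \<otimes> s n = c \<odot> s n" for n
    by (rule smult_eq_mult[symmetric]) (rule cauchy_seqs_carrier[OF s])
  ultimately show ?thesis by simp
qed

lemma cauchy_uminus:
  assumes s: "s \<in> cauchy_seqs M d"
  shows "(\<lambda>n. \<ominus> s n) \<in> cauchy_seqs M d"
  using cauchy_smult[OF s, of "-1"] cauchy_seqs_carrier[OF s]
  by (simp add: smult_minus_one[OF algebra_axioms])

lemma cauchy_minus:
  assumes s: "s \<in> cauchy_seqs M d" and t: "t \<in> cauchy_seqs M d"
  shows "(\<lambda>n. s n \<ominus> t n) \<in> cauchy_seqs M d"
  unfolding a_minus_def by (intro cauchy_add cauchy_uminus s t)

lemma cauchy_algebra_simps [simp]:
  "carrier (cauchy_algebra M d) = cauchy_seqs M d"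
  "s \<otimes>\<^bsub>cauchy_algebra M d\<^esub> t = (\<lambda>n. s n \<otimes> t n)"
  "s \<oplus>\<^bsub>cauchy_algebra M d\<^esub> t = (\<lambda>n. s n \<oplus> t n)"
  "\<one>\<^bsub>cauchy_algebra M d\<^esub> = (\<lambda>n. \<one>)"
  "\<zero>\<^bsub>cauchy_algebra M d\<^esub> = (\<lambda>n. \<zero>)"
  "c \<odot>\<^bsub>cauchy_algebra M d\<^esub> s = (\<lambda>n. c \<odot> s n)"
  by (simp_all add: cauchy_algebra_def)

lemma algebra_cauchy_algebra: "Module.algebra complex_field (cauchy_algebra M d)"
proof (rule algebraI)
  show "cring (cauchy_algebra M d)"
  proof (rule cringI)
    show "abelian_group (cauchy_algebra M d)"
    proof (rule abelian_groupI)
      fix s assume s: "s \<in> carrier (cauchy_algebra M d)"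
      then show "\<exists>t\<in>carrier (cauchy_algebra M d). t \<oplus>\<^bsub>cauchy_algebra M d\<^esub> s = \<zero>\<^bsub>cauchy_algebra M d\<^esub>"
        by (intro bexI[of _ "\<lambda>n. \<ominus> s n"])
          (auto simp: cauchy_uminus M.l_neg cauchy_seqs_carrier)
    qed (auto simp: cauchy_add cauchy_const M.a_ac cauchy_seqs_carrier)
    show "comm_monoid (cauchy_algebra M d)"
      by (rule comm_monoidI) (auto simp: cauchy_mult cauchy_const m_ac cauchy_seqs_carrier)
  qed (auto simp: l_distr cauchy_seqs_carrier)
qed (auto simp: R_cring cauchy_smult cauchy_seqs_carrier smult_r_distr smult_assoc2
      smult_l_distr[simplified] smult_one[simplified] smult_assoc1[simplified])

lemma cauchy_algebra_uminus:
  assumes s: "s \<in> cauchy_seqs M d"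
  shows "\<ominus>\<^bsub>cauchy_algebra M d\<^esub> s = (\<lambda>n. \<ominus> s n)"
proof -
  interpret C: Module.algebra complex_field "cauchy_algebra M d"
    by (rule algebra_cauchy_algebra)
  show ?thesis
    by (rule C.minus_equality)
      (auto simp: s cauchy_uminus M.l_neg cauchy_seqs_carrier)
qed

lemma cauchy_algebra_minus:
  assumes "s \<in> cauchy_seqs M d" "t \<in> cauchy_seqs M d"
  shows "s \<ominus>\<^bsub>cauchy_algebra M d\<^esub> t = (\<lambda>n. s n \<ominus> t n)"
  using assms by (simp add: a_minus_def cauchy_algebra_uminus)

section \<open>The ideal of null sequences\<close>

lemma null_imp_cauchy:
  assumes s: "s \<in> null_seqs M d"
  shows "s \<in> cauchy_seqs M d"
  unfolding cauchy_seqs_iff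
proof (intro conjI allI)
  note [simp] = null_seqs_carrier[OF s]
  show "s n \<in> carrier M" for n by simp
  fix k
  have L: "(\<lambda>n. Q k (s n)) \<longlonglongrightarrow> 0" using s by (simp add: null_seqs_iff)
  have "((\<lambda>i. Q k (s (fst i)) + Q k (s (snd i))) \<longlongrightarrow> 0 + 0) double_limit"
    by (intro tendsto_add filterlim_compose[OF L] filterlim_fst filterlim_snd)
  then show "((\<lambda>i. Q k (s (fst i) \<ominus> s (snd i))) \<longlongrightarrow> 0) double_limit"
    by (rule tendsto_zero_le)
      (auto simp: Q_nonneg seminorm_minus[OF algebra_axioms Q])
qed

lemma null_add:
  assumes s: "s \<in> null_seqs M d" and t: "t \<in> null_seqs M d"
  shows "(\<lambda>n. s n \<oplus> t n) \<in> null_seqs M d"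
  unfolding null_seqs_iff
proof (intro conjI allI)
  note [simp] = null_seqs_carrier[OF s] null_seqs_carrier[OF t]
  show "s n \<oplus> t n \<in> carrier M" for n by simp
  fix k
  have "(\<lambda>n. Q k (s n) + Q k (t n)) \<longlonglongrightarrow> 0 + 0"
    using s t by (intro tendsto_add) (auto simp: null_seqs_iff)
  then show "(\<lambda>n. Q k (s n \<oplus> t n)) \<longlonglongrightarrow> 0"
    by (rule tendsto_zero_le) (auto simp: Q_nonneg Q_add)
qed

lemma null_mult:
  assumes s: "s \<in> cauchy_seqs M d" and t: "t \<in> null_seqs M d"
  shows "(\<lambda>n. s n \<otimes> t n) \<in> null_seqs M d"
  unfolding null_seqs_iff
proof (intro conjI allI)
  note [simp] = cauchy_seqs_carrier[OF s] null_seqs_carrier[OF t]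
  show "s n \<otimes> t n \<in> carrier M" for n by simp
  fix k
  obtain B where B: "0 \<le> B" "\<And>n. Q k (s n) \<le> B" using cauchy_bounded_Q[OF s] by blast
  have "(\<lambda>n. B * Q k (t n)) \<longlonglongrightarrow> B * 0"
    using t by (intro tendsto_intros) (auto simp: null_seqs_iff)
  moreover have le: "Q k (s n \<otimes> t n) \<le> B * Q k (t n)" for n
    by (rule order_trans[OF Q_mult]) (auto intro!: mult_mono B Q_nonneg)
  ultimately show "(\<lambda>n. Q k (s n \<otimes> t n)) \<longlonglongrightarrow> 0"
    by (intro tendsto_zero_le[of "\<lambda>n. B * Q k (t n)" "B * 0", OF _ _ le]) (auto simp: Q_nonneg)
qed

lemma null_uminus: "s \<in> null_seqs M d \<Longrightarrow> (\<lambda>n. \<ominus> s n) \<in> null_seqs M d"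
  by (auto simp: null_seqs_iff Q_uminus)

lemma null_zero: "(\<lambda>n. \<zero>) \<in> null_seqs M d"
  by (simp add: null_seqs_iff Q_zero)

lemma null_seqs_ideal: "ideal (null_seqs M d) (cauchy_algebra M d)"
proof -
  interpret C: Module.algebra complex_field "cauchy_algebra M d"
    by (rule algebra_cauchy_algebra)
  show ?thesis
  proof (rule idealI)
    show "subgroup (null_seqs M d) (add_monoid (cauchy_algebra M d))"
    proof (rule C.add.subgroupI)
      show "null_seqs M d \<noteq> {}" using null_zero by blast
      show "\<ominus>\<^bsub>cauchy_algebra M d\<^esub> s \<in> null_seqs M d" if "s \<in> null_seqs M d" for s
        using cauchy_algebra_uminus[OF null_imp_cauchy[OF that]] null_uminus[OF that] by simp
    qed (auto simp: null_imp_cauchy null_add)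
    show "s \<otimes>\<^bsub>cauchy_algebra M d\<^esub> t \<in> null_seqs M d"
      if "s \<in> null_seqs M d" "t \<in> carrier (cauchy_algebra M d)" for s t
    proof -
      have "(\<lambda>n. s n \<otimes> t n) = (\<lambda>n. t n \<otimes> s n)"
        using that by (intro ext m_comm) (auto simp: cauchy_seqs_carrier null_seqs_carrier)
      then show ?thesis using null_mult[of t s] that by simp
    qed
  qed (auto simp: C.ring_axioms null_mult)
qed

end

text \<open>An arbitrary representative is chosen; \<open>completion_seminorm_tendsto\<close> shows
  that every representative gives the same limit.\<close>

definition completion_seminorm :: "(nat \<Rightarrow> 'a \<Rightarrow> real) \<Rightarrow> nat \<Rightarrow> (nat \<Rightarrow> 'a) set \<Rightarrow> real" where
  "completion_seminorm Q k C = lim (\<lambda>n. Q k ((SOME s. s \<in> C) n))"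

context seminormed_algebra
begin

section \<open>Algebra operations and seminorms on the completion\<close>

abbreviation seq_class :: "(nat \<Rightarrow> 'a) \<Rightarrow> (nat \<Rightarrow> 'a) set" where
  "seq_class s \<equiv> null_seqs M d +>\<^bsub>cauchy_algebra M d\<^esub> s"

abbreviation (input) compl :: "(complex, (nat \<Rightarrow> 'a) set) module" where
  "compl \<equiv> completion M d"

lemma carrier_completion: "carrier compl = seq_class ` cauchy_seqs M d"
  by (simp add: completion_def carrier_quotient_algebra[OF null_seqs_ideal])

lemma seq_class_closed: "s \<in> cauchy_seqs M d \<Longrightarrow> seq_class s \<in> carrier compl"
  by (simp add: carrier_completion)

lemma completion_add:
  "s \<in> cauchy_seqs M d \<Longrightarrow> t \<in> cauchy_seqs M d \<Longrightarrow>
    seq_class s \<oplus>\<^bsub>compl\<^esub> seq_class t = seq_class (\<lambda>n. s n \<oplus> t n)"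
  by (simp add: completion_def quotient_algebra_add[OF null_seqs_ideal])

lemma completion_mult:
  "s \<in> cauchy_seqs M d \<Longrightarrow> t \<in> cauchy_seqs M d \<Longrightarrow>
    seq_class s \<otimes>\<^bsub>compl\<^esub> seq_class t = seq_class (\<lambda>n. s n \<otimes> t n)"
  by (simp add: completion_def quotient_algebra_mult[OF null_seqs_ideal])

lemma completion_smult:
  "s \<in> cauchy_seqs M d \<Longrightarrow> c \<odot>\<^bsub>compl\<^esub> seq_class s = seq_class (\<lambda>n. c \<odot> s n)"
  by (simp add: completion_def quotient_algebra_smult[OF null_seqs_ideal algebra_cauchy_algebra])

lemma completion_minus:
  "s \<in> cauchy_seqs M d \<Longrightarrow> t \<in> cauchy_seqs M d \<Longrightarrow>
    seq_class s \<ominus>\<^bsub>compl\<^esub> seq_class t = seq_class (\<lambda>n. s n \<ominus> t n)"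
  by (simp add: completion_def quotient_algebra_minus[OF null_seqs_ideal algebra_cauchy_algebra]
      cauchy_algebra_minus)

lemma completion_one: "\<one>\<^bsub>compl\<^esub> = seq_class (\<lambda>n. \<one>)"
  by (simp add: completion_def quotient_algebra_one[OF null_seqs_ideal])

lemma completion_zero: "\<zero>\<^bsub>compl\<^esub> = seq_class (\<lambda>n. \<zero>)"
  by (simp add: completion_def quotient_algebra_zero[OF null_seqs_ideal])

lemma algebra_completion: "Module.algebra complex_field compl"
  unfolding completion_def
  by (rule quotient_algebra_algebra[OF null_seqs_ideal algebra_cauchy_algebra])

lemma seq_class_eq_iff:
  "s \<in> cauchy_seqs M d \<Longrightarrow> t \<in> cauchy_seqs M d \<Longrightarrow>
    seq_class s = seq_class t \<longleftrightarrow> (\<lambda>n. s n \<ominus> t n) \<in> null_seqs M d"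
  by (simp add: coset_eq_iff[OF null_seqs_ideal] cauchy_algebra_minus)

lemma seq_class_self:
  assumes "s \<in> cauchy_seqs M d"
  shows "s \<in> seq_class s"
proof -
  interpret N: ideal "null_seqs M d" "cauchy_algebra M d" by (rule null_seqs_ideal)
  show ?thesis using assms by (intro N.a_rcos_self) simp
qed

lemma in_seq_class:
  assumes s: "s \<in> cauchy_seqs M d" and t: "t \<in> seq_class s"
  shows "t \<in> cauchy_seqs M d" "(\<lambda>n. t n \<ominus> s n) \<in> null_seqs M d"
proof -
  obtain h where h: "h \<in> null_seqs M d" "t = (\<lambda>n. h n \<oplus> s n)"
    using t unfolding a_r_coset_def' by auto
  show "t \<in> cauchy_seqs M d"
    unfolding h(2) by (intro cauchy_add null_imp_cauchy h s)
  have "t n \<ominus> s n = h n" for n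
    unfolding h(2) using null_seqs_carrier[OF h(1), of n] cauchy_seqs_carrier[OF s, of n]
    by (simp add: a_minus_def M.a_assoc M.r_neg)
  then show "(\<lambda>n. t n \<ominus> s n) \<in> null_seqs M d" using h by simp
qed

text \<open>Two representatives differ by a null sequence, so the reverse triangle inequality gives
  their seminorms the same limit.\<close>

lemma completion_seminorm_tendsto:
  assumes s: "s \<in> cauchy_seqs M d"
  shows "(\<lambda>n. Q k (s n)) \<longlonglongrightarrow> completion_seminorm Q k (seq_class s)"
proof -
  define t where "t = (SOME t. t \<in> seq_class s)"
  have t: "t \<in> seq_class s" unfolding t_def by (rule someI[of "\<lambda>t. t \<in> seq_class s", OF seq_class_self[OF s]])
  note tc = in_seq_class[OF s t]
  have L: "(\<lambda>n. Q k (t n)) \<longlonglongrightarrow> completion_seminorm Q k (seq_class s)"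
    unfolding completion_seminorm_def t_def[symmetric]
    using cauchy_convergent_Q[OF tc(1)] by (simp add: convergent_LIMSEQ_iff)
  have "(\<lambda>n. Q k (t n \<ominus> s n)) \<longlonglongrightarrow> 0" using tc(2) by (simp add: null_seqs_iff)
  then have "(\<lambda>n. Q k (s n) - Q k (t n)) \<longlonglongrightarrow> 0"
  proof (rule Lim_null_comparison[rotated], intro always_eventually allI)
    fix n show "norm (Q k (s n) - Q k (t n)) \<le> Q k (t n \<ominus> s n)"
      using Q_diff[of "t n" "s n" k] cauchy_seqs_carrier[OF s] cauchy_seqs_carrier[OF tc(1)]
      by (simp add: abs_minus_commute)
  qed
  from tendsto_add[OF this L] show ?thesis by simp
qed

section \<open>The metric of the completion and its completeness\<close>

lemma d_minus_diff:
  assumes "x \<in> carrier M" "y \<in> carrier M" "x' \<in> carrier M" "y' \<in> carrier M"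
  shows "\<bar>d (x \<ominus> y) - d (x' \<ominus> y')\<bar> \<le> d (x \<ominus> x') + d (y \<ominus> y')"
  using d_triangle[of x x' y] d_triangle[of x' y' y] d_triangle[of x' x y'] d_triangle[of x y y']
    d_minus_commute[of x x'] d_minus_commute[of y y'] assms
  by linarith

text \<open>The quadrilateral inequality \<open>d_minus_diff\<close> is used twice: it makes the
  distances a Cauchy sequence, and it shows that changing the representatives does not change the
  limit. Together these justify the definite description in
  \<open>completion_metric\<close>.\<close>

lemma completion_metric_tendsto:
  assumes s: "s \<in> cauchy_seqs M d" and t: "t \<in> cauchy_seqs M d"
  shows "(\<lambda>n. d (s n \<ominus> t n)) \<longlonglongrightarrow> completion_metric M d (seq_class s) (seq_class t)"
proof -
  note sc [simp] = cauchy_seqs_carrier[OF s] and tc [simp] = cauchy_seqs_carrier[OF t]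
  have "((\<lambda>i. d (s (fst i) \<ominus> s (snd i)) + d (t (fst i) \<ominus> t (snd i))) \<longlongrightarrow> 0 + 0) double_limit"
    using s t by (intro tendsto_add) (auto simp: cauchy_seqs_iff_d)
  then have "convergent (\<lambda>n. d (s n \<ominus> t n))"
    by (intro Cauchy_double_limit[of "\<lambda>m n. d (s m \<ominus> s n) + d (t m \<ominus> t n)"])
      (simp_all add: d_minus_diff)
  then obtain l where l: "(\<lambda>n. d (s n \<ominus> t n)) \<longlonglongrightarrow> l" by (auto simp: convergent_def)
  have "(\<lambda>n. d (s' n \<ominus> t' n)) \<longlonglongrightarrow> l"
    if s': "s' \<in> seq_class s" and t': "t' \<in> seq_class t" for s' t'
  proof -
    note [simp] = cauchy_seqs_carrier[OF in_seq_class(1)[OF s s']]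
      cauchy_seqs_carrier[OF in_seq_class(1)[OF t t']]
    have "(\<lambda>n. d (s' n \<ominus> s n) + d (t' n \<ominus> t n)) \<longlonglongrightarrow> 0 + 0"
      using in_seq_class(2)[OF s s'] in_seq_class(2)[OF t t']
      by (intro tendsto_add) (auto simp: null_seqs_def)
    then have "(\<lambda>n. d (s' n \<ominus> t' n) - d (s n \<ominus> t n)) \<longlonglongrightarrow> 0"
      by (intro Lim_null_comparison[of "\<lambda>n. d (s' n \<ominus> t' n) - d (s n \<ominus> t n)"
            "\<lambda>n. d (s' n \<ominus> s n) + d (t' n \<ominus> t n)"])
        (auto intro!: always_eventually d_minus_diff)
    from tendsto_add[OF this l] show ?thesis by simp
  qed
  then have "(THE l. \<forall>s'\<in>seq_class s. \<forall>t'\<in>seq_class t. (\<lambda>n. d (s' n \<ominus> t' n)) \<longlonglongrightarrow> l) = l"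
    using seq_class_self[OF s] seq_class_self[OF t] LIMSEQ_unique[OF _ l]
    by (intro the_equality) blast+
  then show ?thesis using l by (simp add: completion_metric_def seq_class_closed s t)
qed

lemma completion_metric_le:
  assumes s: "s \<in> cauchy_seqs M d" and t: "t \<in> cauchy_seqs M d"
    and "\<forall>\<^sub>F n in sequentially. d (s n \<ominus> t n) \<le> e"
  shows "completion_metric M d (seq_class s) (seq_class t) \<le> e"
  using completion_metric_tendsto[OF s t] assms(3)
  by (intro tendsto_upperbound[of _ _ sequentially]) auto

lemma completion_metric_nonneg: "0 \<le> completion_metric M d C E"
proof (cases "C \<in> carrier compl \<and> E \<in> carrier compl")
  case True
  then obtain s t where st: "s \<in> cauchy_seqs M d" "t \<in> cauchy_seqs M d"
    and CE: "C = seq_class s" "E = seq_class t"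
    by (auto simp: carrier_completion)
  show ?thesis unfolding CE
    by (rule tendsto_lowerbound[OF completion_metric_tendsto[OF st]])
      (auto simp: d_nonneg cauchy_seqs_carrier st)
qed (auto simp: completion_metric_def)

lemma completion_metric_commute: "completion_metric M d C E = completion_metric M d E C"
proof (cases "C \<in> carrier compl \<and> E \<in> carrier compl")
  case True
  then obtain s t where st: "s \<in> cauchy_seqs M d" "t \<in> cauchy_seqs M d"
    and CE: "C = seq_class s" "E = seq_class t"
    by (auto simp: carrier_completion)
  have "(\<lambda>n. d (s n \<ominus> t n)) = (\<lambda>n. d (t n \<ominus> s n))"
    using st by (intro ext d_minus_commute) (auto simp: cauchy_seqs_carrier)
  then show ?thesis unfolding CE
    using completion_metric_tendsto[OF st] completion_metric_tendsto[OF st(2,1)]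
    by (auto intro: LIMSEQ_unique)
qed (auto simp: completion_metric_def)

lemma completion_metric_space: "Metric_space (carrier compl) (completion_metric M d)"
proof
  fix C E assume "C \<in> carrier compl" "E \<in> carrier compl"
  then obtain s t where st: "s \<in> cauchy_seqs M d" "t \<in> cauchy_seqs M d"
    and CE: "C = seq_class s" "E = seq_class t"
    by (auto simp: carrier_completion)
  have "completion_metric M d C E = 0 \<longleftrightarrow> (\<lambda>n. d (s n \<ominus> t n)) \<longlonglongrightarrow> 0"
    unfolding CE using completion_metric_tendsto[OF st] by (auto intro: LIMSEQ_unique)
  also have "\<dots> \<longleftrightarrow> C = E"
    unfolding CE seq_class_eq_iff[OF st]
    by (simp add: null_seqs_def image_subset_iff cauchy_seqs_carrier[OF st(1)] cauchy_seqs_carrier[OF st(2)])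
  finally show "completion_metric M d C E = 0 \<longleftrightarrow> C = E" .
  fix F assume "F \<in> carrier compl"
  then obtain u where u: "u \<in> cauchy_seqs M d" and F: "F = seq_class u"
    by (auto simp: carrier_completion)
  show "completion_metric M d C F \<le> completion_metric M d C E + completion_metric M d E F"
    unfolding CE F
    by (rule tendsto_le[OF _ tendsto_add[OF completion_metric_tendsto completion_metric_tendsto]
          completion_metric_tendsto])
      (auto intro!: always_eventually d_triangle simp: st u cauchy_seqs_carrier)
qed (auto simp: completion_metric_nonneg intro: completion_metric_commute)

sublocale completion: Metric_space "carrier (completion M d)" "completion_metric M d"
  by (rule completion_metric_space)

text \<open>A diagonal argument. Each \<open>\<sigma> j\<close> is approximated by the class of a
  constant sequence \<open>a j\<close>, and the sequence \<open>a\<close> of these elements is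
  itself Cauchy and represents the limit.\<close>

lemma mcomplete_completion: "completion.mcomplete"
  unfolding completion.mcomplete_def
proof (intro allI impI)
  fix \<sigma> assume \<sigma>: "completion.MCauchy \<sigma>"
  then have "range \<sigma> \<subseteq> carrier compl" by (simp add: completion.MCauchy_def)
  then have "\<exists>s\<in>cauchy_seqs M d. \<sigma> j = seq_class s" for j
    by (metis carrier_completion imageE rangeI subsetD)
  then obtain s where s: "\<And>j. s j \<in> cauchy_seqs M d" and \<sigma>s: "\<And>j. \<sigma> j = seq_class (s j)"
    by metis
  have "\<exists>N. \<forall>m\<ge>N. \<forall>n\<ge>N. d (s j m \<ominus> s j n) < 1 / Suc j" for j
    using s[of j] by (auto simp: cauchy_seqs_def)
  then obtain N where N: "\<And>j m n. m \<ge> N j \<Longrightarrow> n \<ge> N j \<Longrightarrow> d (s j m \<ominus> s j n) < 1 / Suc j"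
    by metis
  \<comment> \<open>From index \<open>N j\<close> on, the representative \<open>s j\<close> stays
    within \<open>1 / Suc j\<close> of its entry \<open>a j\<close>, so the class of the constant
    \<open>a j\<close> is that close to \<open>\<sigma> j\<close>.\<close>
  define a where "a j = s j (N j)" for j
  have a: "a j \<in> carrier M" for j unfolding a_def by (rule cauchy_seqs_carrier[OF s])
  let ?D = "completion_metric M d"
  have near: "?D (\<sigma> j) (seq_class (\<lambda>n. a j)) \<le> 1 / Suc j" for j
    unfolding \<sigma>s
    using N[of j] by (intro completion_metric_le s cauchy_const a)
      (auto simp: eventually_sequentially a_def intro!: exI[of _ "N j"] less_imp_le)
  have const: "?D (seq_class (\<lambda>n. a i)) (seq_class (\<lambda>n. a j)) = d (a i \<ominus> a j)" for i j
    using completion_metric_tendsto[OF cauchy_const[OF a] cauchy_const[OF a]]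
    by (auto intro: LIMSEQ_unique)
  have da: "d (a i \<ominus> a j) \<le> 1 / Suc i + ?D (\<sigma> i) (\<sigma> j) + 1 / Suc j" for i j
  proof -
    have c: "\<sigma> i \<in> carrier compl" "seq_class (\<lambda>n. a i) \<in> carrier compl" for i
      by (auto simp: \<sigma>s intro!: seq_class_closed s cauchy_const a)
    show ?thesis
      using completion.triangle[OF c(2)[of i] c(1)[of i] c(2)[of j]]
        completion.triangle[OF c(1)[of i] c(1)[of j] c(2)[of j]]
        near[of i] near[of j] const[of i j] completion.commute[of "\<sigma> i" "seq_class (\<lambda>n. a i)"]
      by linarith
  qed
  have inv: "\<exists>K. \<forall>i\<ge>K. 1 / real (Suc i) < e" if "0 < e" for e :: real
    using order_tendstoD(2)[OF LIMSEQ_Suc[OF lim_1_over_n] that] by (simp add: eventually_sequentially)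
  have ac: "a \<in> cauchy_seqs M d"
    unfolding cauchy_seqs_def
  proof (intro CollectI conjI allI impI)
    show "range a \<subseteq> carrier M" using a by auto
    fix e :: real assume e: "0 < e"
    obtain K where K: "\<And>i. i \<ge> K \<Longrightarrow> 1 / Suc i < e / 3" using inv[of "e / 3"] e by auto
    obtain L where L: "\<And>i j. i \<ge> L \<Longrightarrow> j \<ge> L \<Longrightarrow> ?D (\<sigma> i) (\<sigma> j) < e / 3"
      using \<sigma> e unfolding completion.MCauchy_def by (metis zero_less_divide_iff zero_less_numeral)
    show "\<exists>N. \<forall>m\<ge>N. \<forall>n\<ge>N. d (a m \<ominus> a n) < e"
    proof (intro exI[of _ "max K L"] allI impI)
      fix m n assume "max K L \<le> m" "max K L \<le> n"
      then show "d (a m \<ominus> a n) < e"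
        using da[of m n] K[of m] K[of n] L[of m n] by simp
    qed
  qed
  have "limitin completion.mtopology \<sigma> (seq_class a) sequentially"
    unfolding completion.limitin_metric
  proof (intro conjI allI impI)
    show "seq_class a \<in> carrier compl" by (rule seq_class_closed[OF ac])
    fix e :: real assume e: "0 < e"
    obtain K where K: "\<And>i. i \<ge> K \<Longrightarrow> 1 / Suc i < e / 2" using inv[of "e / 2"] e by auto
    obtain L where L: "\<And>i j. i \<ge> L \<Longrightarrow> j \<ge> L \<Longrightarrow> d (a i \<ominus> a j) < e / 3"
      using ac e unfolding cauchy_seqs_def mem_Collect_eq
      by (metis zero_less_divide_iff zero_less_numeral)
    have "\<sigma> i \<in> carrier compl \<and> ?D (\<sigma> i) (seq_class a) < e" if i: "i \<ge> max K L" for i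
    proof
      show c: "\<sigma> i \<in> carrier compl" unfolding \<sigma>s by (rule seq_class_closed[OF s])
      have "?D (seq_class (\<lambda>n. a i)) (seq_class a) \<le> e / 3"
        using i L by (intro completion_metric_le cauchy_const a ac)
          (auto simp: eventually_sequentially intro!: exI[of _ L] less_imp_le)
      then show "?D (\<sigma> i) (seq_class a) < e"
        using completion.triangle[OF c seq_class_closed[OF cauchy_const[OF a]] seq_class_closed[OF ac], of i]
          near[of i] K[of i] i e by simp
    qed
    then show "\<forall>\<^sub>F i in sequentially. \<sigma> i \<in> carrier compl \<and> ?D (\<sigma> i) (seq_class a) < e"
      by (rule eventually_sequentiallyI)
  qed
  then show "\<exists>x. limitin completion.mtopology \<sigma> x sequentially" by blast
qed

section \<open>The seminorms define the topology of the completion\<close>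

lemma completion_seminorm_le:
  assumes s: "s \<in> cauchy_seqs M d"
    and "\<forall>\<^sub>F n in sequentially. Q k (s n) \<le> e"
  shows "completion_seminorm Q k (seq_class s) \<le> e"
  using completion_seminorm_tendsto[OF s] assms(2)
  by (intro tendsto_upperbound[of _ _ sequentially]) auto

lemma completion_topology_eq:
  "completion_topology M d = seminorm_topology compl (completion_seminorm Q)"
proof -
  let ?D = "completion_metric M d" and ?Q = "completion_seminorm Q"
  have *: "(\<exists>r>0. completion.mball C r \<subseteq> U) \<longleftrightarrow>
      (\<exists>k. \<exists>e>0. {E \<in> carrier compl. \<forall>j\<le>k. ?Q j (E \<ominus>\<^bsub>compl\<^esub> C) < e} \<subseteq> U)"
    if C: "C \<in> carrier compl" for C U
  proof
    obtain s where s: "s \<in> cauchy_seqs M d" "C = seq_class s"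
      using C by (auto simp: carrier_completion)
    {
      assume "\<exists>r>0. completion.mball C r \<subseteq> U"
      then obtain r where r: "0 < r" "completion.mball C r \<subseteq> U" by blast
      \<comment> \<open>Half of \<open>r\<close> is taken because a strict bound on the entries
        becomes a weak one in the limit. The converse direction uses \<open>e / 2\<close> for the
        same reason.\<close>
      obtain k \<delta> where \<delta>: "0 < \<delta>" "\<And>x. x \<in> carrier M \<Longrightarrow> Q k x < \<delta> \<Longrightarrow> d x < r / 2"
        using d_small[of "r / 2"] r(1) by auto
      have "E \<in> completion.mball C r"
        if E: "E \<in> carrier compl" "?Q k (E \<ominus>\<^bsub>compl\<^esub> C) < \<delta>" for E
      proof -
        obtain t where t: "t \<in> cauchy_seqs M d" "E = seq_class t"
          using E by (auto simp: carrier_completion)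
        note ts = cauchy_minus[OF t(1) s(1)]
        have "\<forall>\<^sub>F n in sequentially. Q k (t n \<ominus> s n) < \<delta>"
          using completion_seminorm_tendsto[OF ts, of k] E(2)
          by (simp add: s t completion_minus order_tendstoD)
        then have "\<forall>\<^sub>F n in sequentially. d (t n \<ominus> s n) \<le> r / 2"
          by eventually_elim (intro less_imp_le \<delta>(2) cauchy_seqs_carrier[OF ts])
        then have "?D E C \<le> r / 2"
          unfolding s t by (intro completion_metric_le s t)
        then show ?thesis using C E r completion.commute[of E C] by simp
      qed
      then show "\<exists>k. \<exists>e>0. {E \<in> carrier compl. \<forall>j\<le>k. ?Q j (E \<ominus>\<^bsub>compl\<^esub> C) < e} \<subseteq> U"
        using r \<delta>(1) by (intro exI[of _ k] exI[of _ \<delta>] conjI) auto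
    next
      assume "\<exists>k. \<exists>e>0. {E \<in> carrier compl. \<forall>j\<le>k. ?Q j (E \<ominus>\<^bsub>compl\<^esub> C) < e} \<subseteq> U"
      then obtain k e where e: "0 < e"
        "{E \<in> carrier compl. \<forall>j\<le>k. ?Q j (E \<ominus>\<^bsub>compl\<^esub> C) < e} \<subseteq> U" by blast
      obtain \<delta> where \<delta>: "0 < \<delta>" "\<And>x. x \<in> carrier M \<Longrightarrow> d x < \<delta> \<Longrightarrow> Q k x < e / 2"
        using Q_small[of "e / 2" k] e(1) by auto
      have "?Q j (E \<ominus>\<^bsub>compl\<^esub> C) < e" if E: "E \<in> completion.mball C \<delta>" and j: "j \<le> k" for E j
      proof -
        obtain t where t: "t \<in> cauchy_seqs M d" "E = seq_class t"
          using E completion.mball_subset_mspace carrier_completion by blast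
        note ts = cauchy_minus[OF t(1) s(1)]
        have "?D E C < \<delta>" using E completion.commute[of E C] by simp
        then have "\<forall>\<^sub>F n in sequentially. d (t n \<ominus> s n) < \<delta>"
          using completion_metric_tendsto[OF t(1) s(1)] by (simp add: s t order_tendstoD)
        then have "\<forall>\<^sub>F n in sequentially. Q j (t n \<ominus> s n) \<le> e / 2"
          by eventually_elim
            (intro less_imp_le le_less_trans[OF Q_mono'[OF j]] \<delta>(2) cauchy_seqs_carrier[OF ts])
        then have "?Q j (E \<ominus>\<^bsub>compl\<^esub> C) \<le> e / 2"
          unfolding s t completion_minus[OF t(1) s(1)] by (rule completion_seminorm_le[OF ts])
        then show ?thesis using e by simp
      qed
      then show "\<exists>r>0. completion.mball C r \<subseteq> U"
        using e(2) \<delta>(1) by (intro exI[of _ \<delta>]) (auto simp: subset_iff)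
    }
  qed
  \<comment> \<open>Equality of the two predicates suffices, since \<open>openin_inverse\<close>
    recovers a topology from its open sets. That the predicate built from the seminorms does
    describe a topology comes as a by-product.\<close>
  have "openin completion.mtopology = (\<lambda>U. U \<subseteq> carrier compl \<and>
    (\<forall>C\<in>U. \<exists>k. \<exists>e>0. {E \<in> carrier compl. \<forall>j\<le>k. ?Q j (E \<ominus>\<^bsub>compl\<^esub> C) < e} \<subseteq> U))"
    by (intro ext, unfold completion.openin_mtopology) (use * in blast)
  then show ?thesis
    unfolding completion_topology_def seminorm_topology_def by (metis openin_inverse)
qed

lemma submultiplicative_completion_seminorm:
  "submultiplicative_seminorm compl (completion_seminorm Q k)"
  unfolding submultiplicative_seminorm_def
proof (intro conjI ballI allI)
  let ?Q = "completion_seminorm Q k"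
  fix C assume "C \<in> carrier compl"
  then obtain s where s: "s \<in> cauchy_seqs M d" "C = seq_class s"
    by (auto simp: carrier_completion)
  note [simp] = cauchy_seqs_carrier[OF s(1)]
  note S = completion_seminorm_tendsto[OF s(1), of k]
  show "0 \<le> ?Q C"
    unfolding s by (rule tendsto_lowerbound[OF S]) (auto simp: Q_nonneg)
  show "?Q (c \<odot>\<^bsub>compl\<^esub> C) = cmod c * ?Q C" for c
  proof -
    have "(\<lambda>n. Q k (c \<odot> s n)) \<longlonglongrightarrow> cmod c * ?Q C"
      using tendsto_mult_left[OF S, of "cmod c"] by (simp add: Q_smult s)
    then show ?thesis
      using completion_seminorm_tendsto[OF cauchy_smult[OF s(1)], of k c]
      by (auto simp: s completion_smult intro: LIMSEQ_unique)
  qed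
  fix E assume "E \<in> carrier compl"
  then obtain t where t: "t \<in> cauchy_seqs M d" "E = seq_class t"
    by (auto simp: carrier_completion)
  note [simp] = cauchy_seqs_carrier[OF t(1)]
  note T = completion_seminorm_tendsto[OF t(1), of k]
  show "?Q (C \<oplus>\<^bsub>compl\<^esub> E) \<le> ?Q C + ?Q E"
    unfolding s t completion_add[OF s(1) t(1)]
    by (rule tendsto_le[OF _ tendsto_add[OF S T] completion_seminorm_tendsto[OF cauchy_add[OF s(1) t(1)]]])
      (auto simp: Q_add)
  show "?Q (C \<otimes>\<^bsub>compl\<^esub> E) \<le> ?Q C * ?Q E"
    unfolding s t completion_mult[OF s(1) t(1)]
    by (rule tendsto_le[OF _ tendsto_mult[OF S T] completion_seminorm_tendsto[OF cauchy_mult[OF s(1) t(1)]]])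
      (auto simp: Q_mult)
qed

lemma completion_seminorm_mono:
  assumes "C \<in> carrier compl"
  shows "completion_seminorm Q k C \<le> completion_seminorm Q (Suc k) C"
proof -
  obtain s where s: "s \<in> cauchy_seqs M d" "C = seq_class s"
    using assms by (auto simp: carrier_completion)
  show ?thesis unfolding s
    by (rule tendsto_le[OF _ completion_seminorm_tendsto completion_seminorm_tendsto])
      (auto simp: s cauchy_seqs_carrier Q_mono)
qed

theorem frechet_algebra_completion:
  "frechet_algebra compl (completion_topology M d) (completion_seminorm Q)"
  unfolding frechet_algebra_def
  using algebra_completion submultiplicative_completion_seminorm completion_seminorm_mono
    completion_topology_eq completion.completely_metrizable_space_mtopology[OF mcomplete_completion]
  by (auto simp: completion_topology_def)

end

section \<open>Spectra in the Banach algebras of a seminorm\<close>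

text \<open>A single seminorm can serve both as the metric and as the whole family of seminorms. In
  this way each \<open>banach_quotient\<close> falls under the general construction.\<close>

lemma seminormed_algebra_const:
  assumes A: "Module.algebra complex_field M" and p: "submultiplicative_seminorm M p"
  shows "seminormed_algebra M p (\<lambda>k. p)"
  unfolding seminormed_algebra_def seminormed_algebra_axioms_def
  using A p seminorm_nonneg[OF A p] seminorm_add[OF A p] seminorm_uminus[OF A p] by blast

context
  fixes B :: "(complex, 'a) module" (structure) and p :: "'a \<Rightarrow> real"
  assumes alg: "Module.algebra complex_field B" and p: "submultiplicative_seminorm B p"
begin

interpretation Module.algebra complex_field B by (rule alg)

abbreviation "ker_quotient \<equiv> quotient_algebra B (seminorm_kernel B p)"

interpretation Q: seminormed_algebra ker_quotient "quotient_norm p" "\<lambda>k. quotient_norm p"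
  by (intro seminormed_algebra_const submultiplicative_quotient_norm alg p
      quotient_algebra_algebra seminorm_kernel_ideal)

lemma quotient_image_closed:
  "x \<in> carrier B \<Longrightarrow> (\<lambda>n. seminorm_kernel B p +> x) \<in> cauchy_seqs ker_quotient (quotient_norm p)"
  by (intro Q.cauchy_const) (simp add: carrier_quotient_algebra[OF seminorm_kernel_ideal[OF alg p]])

lemma banach_quotient_image_closed:
  "x \<in> carrier B \<Longrightarrow> banach_quotient_image B p x \<in> carrier (banach_quotient B p)"
  unfolding banach_quotient_def banach_quotient_image_def completion_embed_def
  by (intro Q.seq_class_closed quotient_image_closed)

lemma banach_quotient_image_mult:
  assumes "x \<in> carrier B" "y \<in> carrier B"
  shows "banach_quotient_image B p x \<otimes>\<^bsub>banach_quotient B p\<^esub> banach_quotient_image B p y =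
    banach_quotient_image B p (x \<otimes> y)"
  unfolding banach_quotient_def banach_quotient_image_def completion_embed_def
  by (simp add: Q.completion_mult quotient_image_closed assms
      quotient_algebra_mult[OF seminorm_kernel_ideal[OF alg p]])

lemma banach_quotient_image_minus:
  assumes "x \<in> carrier B" "y \<in> carrier B"
  shows "banach_quotient_image B p x \<ominus>\<^bsub>banach_quotient B p\<^esub> banach_quotient_image B p y =
    banach_quotient_image B p (x \<ominus> y)"
  unfolding banach_quotient_def banach_quotient_image_def completion_embed_def
  by (simp add: Q.completion_minus quotient_image_closed assms
      quotient_algebra_minus[OF seminorm_kernel_ideal[OF alg p] alg])

lemma banach_quotient_image_smult:
  assumes "x \<in> carrier B"
  shows "c \<odot>\<^bsub>banach_quotient B p\<^esub> banach_quotient_image B p x = banach_quotient_image B p (c \<odot> x)"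
  unfolding banach_quotient_def banach_quotient_image_def completion_embed_def
  by (simp add: Q.completion_smult quotient_image_closed assms
      quotient_algebra_smult[OF seminorm_kernel_ideal[OF alg p] alg])

lemma banach_quotient_image_one:
  "banach_quotient_image B p \<one> = \<one>\<^bsub>banach_quotient B p\<^esub>"
  unfolding banach_quotient_def banach_quotient_image_def completion_embed_def
  by (simp add: Q.completion_one quotient_algebra_one[OF seminorm_kernel_ideal[OF alg p]])

lemma banach_quotient_image_Units:
  assumes "x \<in> Units B"
  shows "banach_quotient_image B p x \<in> Units (banach_quotient B p)"
proof -
  obtain y where y: "y \<in> carrier B" "x \<otimes> y = \<one>" "y \<otimes> x = \<one>" and x: "x \<in> carrier B"
    using assms by (auto simp: Units_def)
  show ?thesis unfolding Units_def
    by (intro CollectI conjI bexI[of _ "banach_quotient_image B p y"])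
      (simp_all add: banach_quotient_image_closed banach_quotient_image_mult x y
        banach_quotient_image_one)
qed

text \<open>The map into \<open>banach_quotient B p\<close> is a unital homomorphism and so
  preserves units; the spectrum can only shrink.\<close>

lemma spectrum_banach_quotient_subset:
  assumes "x \<in> carrier B"
  shows "spectrum (banach_quotient B p) (banach_quotient_image B p x) \<subseteq> spectrum B x"
  using assms banach_quotient_image_Units
  by (auto simp: spectrum_def banach_quotient_image_smult banach_quotient_image_minus
      simp flip: banach_quotient_image_one)

end

text \<open>The condition on the spectrum does not mention \<open>P\<close>, so a single element can
  be used for every defining sequence of seminorms.\<close>

lemma quasinilpotentI:
  assumes "frechet_algebra B T P" and x: "x \<in> carrier B" and spec: "spectrum B x \<subseteq> {0}"
  shows "quasinilpotent B P x"
proof -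
  have "spectral_radius (banach_quotient B (P k)) (banach_quotient_image B (P k) x) = 0" for k
  proof -
    have "spectrum (banach_quotient B (P k)) (banach_quotient_image B (P k) x) \<subseteq> {0}"
      using spectrum_banach_quotient_subset[of B "P k" x] assms by (auto simp: frechet_algebra_def)
    \<comment> \<open>Only an upper bound is proved here: the spectrum may be empty, for instance
      when \<open>P k\<close> vanishes identically, and its supremum in \<open>ennreal\<close> is
      then 0 as well.\<close>
    then have "spectral_radius (banach_quotient B (P k)) (banach_quotient_image B (P k) x) \<le> 0"
      unfolding spectral_radius_def by (intro SUP_least) auto
    then show ?thesis by simp
  qed
  then show ?thesis using x by (simp add: quasinilpotent_def)
qed

section \<open>Taylor coefficients at 1 and the disc norm\<close>

abbreviation (input) taylor :: "nat \<Rightarrow> complex poly \<Rightarrow> complex" where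
  "taylor \<equiv> taylor_functional"

text \<open>Substituting z + 1 for z moves the expansion point from 1 to 0, so that the rules for
  Taylor coefficients below become rules for coefficients of polynomials.\<close>

lemma taylor_coeff: "taylor i p = coeff (pcompose p [:1, 1:]) i"
proof -
  have "(pderiv ^^ i) (pcompose p [:1, 1:]) = pcompose ((pderiv ^^ i) p) [:1, 1:]"
    by (induction i) (simp_all add: pderiv_pcompose pderiv_pCons)
  then have "coeff ((pderiv ^^ i) (pcompose p [:1, 1:])) 0 = poly ((pderiv ^^ i) p) 1"
    by (simp add: poly_pcompose flip: poly_0_coeff_0)
  then have "fact i * coeff (pcompose p [:1, 1:]) i = poly ((pderiv ^^ i) p) 1"
    by (simp add: coeff_higher_pderiv pochhammer_fact)
  then show ?thesis by (simp add: taylor_functional_def field_simps)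
qed

lemma taylor_0: "taylor 0 p = poly p 1"
  by (simp add: taylor_functional_def)

lemma taylor_add: "taylor i (p + q) = taylor i p + taylor i q"
  by (simp add: taylor_coeff pcompose_add)

lemma taylor_diff: "taylor i (p - q) = taylor i p - taylor i q"
  by (simp add: taylor_coeff pcompose_diff)

lemma taylor_uminus: "taylor i (- p) = - taylor i p"
  by (simp add: taylor_coeff pcompose_uminus)

lemma taylor_smult: "taylor i (smult c p) = c * taylor i p"
  by (simp add: taylor_coeff pcompose_smult)

lemma taylor_sum: "taylor i (sum f A) = (\<Sum>a\<in>A. taylor i (f a))"
  by (simp add: taylor_coeff pcompose_sum coeff_sum)

lemma taylor_mult: "taylor i (p * q) = (\<Sum>j\<le>i. taylor j p * taylor (i - j) q)"
  by (simp add: taylor_coeff pcompose_mult coeff_mult)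

lemma taylor_const: "taylor i [:c:] = (if i = 0 then c else 0)"
  by (simp add: taylor_coeff pcompose_const coeff_pCons split: nat.split)

lemma taylor_one: "taylor i 1 = (if i = 0 then 1 else 0)"
  using taylor_const[of i 1] by (simp flip: one_pCons)

lemma taylor_pderiv: "taylor i (pderiv p) = of_nat (Suc i) * taylor (Suc i) p"
proof -
  have "pcompose (pderiv p) [:1, 1:] = pderiv (pcompose p [:1, 1:])"
    by (simp add: pderiv_pcompose pderiv_pCons)
  then show ?thesis by (simp add: taylor_coeff coeff_pderiv)
qed

text \<open>In powers of z - 1 the factor z is 1 + (z - 1). This turns an equation for z times a
  derivative into a recursion for coefficients.\<close>

lemma taylor_X_mult_Suc: "taylor (Suc i) ([:0, 1:] * q) = taylor (Suc i) q + taylor i q"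
proof -
  have "pcompose ([:0, 1:] * q) [:1, 1:] = pcompose q [:1, 1:] + pCons 0 (pcompose q [:1, 1:])"
    by (simp add: pcompose_mult pcompose_pCons)
  then show ?thesis by (simp add: taylor_coeff)
qed

lemma taylor_power_eq_0:
  assumes "taylor 0 u = 0" "i < n"
  shows "taylor i (u ^ n) = 0"
  using assms(2)
proof (induction n arbitrary: i)
  case (Suc n)
  have "taylor j u * taylor (i - j) (u ^ n) = 0" if "j \<le> i" for j
    using Suc that by (cases "j = 0") (auto simp: assms(1))
  then show ?case unfolding power_Suc taylor_mult by (intro sum.neutral) simp
qed simp

text \<open>In the convolution for \<open>u * u ^ n\<close> only the index 1 survives: index 0 is
  killed by \<open>u\<close> vanishing at 1, and a larger index asks for a coefficient of
  \<open>u ^ n\<close> of order below \<open>n\<close>.\<close>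

lemma taylor_power_same:
  assumes "taylor 0 u = 0"
  shows "taylor n (u ^ n) = taylor 1 u ^ n"
proof (induction n)
  case (Suc n)
  have "taylor (Suc n) (u * u ^ n) =
      (\<Sum>j\<in>{..Suc n}. if j = 1 then taylor 1 u * taylor n (u ^ n) else 0)"
    unfolding taylor_mult
  proof (intro sum.cong refl)
    fix j assume "j \<in> {..Suc n}"
    then show "taylor j u * taylor (Suc n - j) (u ^ n) =
        (if j = 1 then taylor 1 u * taylor n (u ^ n) else 0)"
      using assms taylor_power_eq_0[of u "Suc n - j" n] by (cases j) auto
  qed
  also have "\<dots> = taylor 1 u * taylor n (u ^ n)"
    by (subst sum.delta) simp_all
  finally show ?case using Suc by simp
qed (simp add: taylor_one)

lemma bdd_above_disc: "bdd_above ((\<lambda>z. cmod (poly p z)) ` cball 0 1)"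
  by (intro bounded_imp_bdd_above compact_imp_bounded compact_continuous_image continuous_intros)
    simp

lemma disc_norm_upper: "cmod z \<le> 1 \<Longrightarrow> cmod (poly p z) \<le> disc_norm p"
  unfolding disc_norm_def by (rule cSUP_upper[OF _ bdd_above_disc]) simp

lemma disc_norm_least: "(\<And>z. cmod z \<le> 1 \<Longrightarrow> cmod (poly p z) \<le> b) \<Longrightarrow> disc_norm p \<le> b"
  unfolding disc_norm_def by (rule cSUP_least) (auto simp: cball_eq_empty)

lemma disc_norm_nonneg: "0 \<le> disc_norm p"
  using disc_norm_upper[of 0 p] norm_ge_zero[of "poly p 0"] by (simp del: norm_ge_zero)

lemma disc_norm_add: "disc_norm (p + q) \<le> disc_norm p + disc_norm q"
  by (intro disc_norm_least) (auto intro!: norm_triangle_mono disc_norm_upper)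

lemma disc_norm_mult: "disc_norm (p * q) \<le> disc_norm p * disc_norm q"
  by (intro disc_norm_least) (auto simp: norm_mult intro!: mult_mono disc_norm_upper disc_norm_nonneg)

lemma disc_norm_const: "disc_norm [:c:] = cmod c"
  by (intro antisym disc_norm_least) (use disc_norm_upper[of 0 "[:c:]"] in auto)

lemma disc_norm_smult: "disc_norm (smult c p) = cmod c * disc_norm p"
proof (cases "c = 0")
  case False
  have le: "disc_norm (smult c p) \<le> cmod c * disc_norm p" for c p
    using disc_norm_mult[of "[:c:]" p] by (simp add: disc_norm_const)
  have "disc_norm p \<le> cmod (inverse c) * disc_norm (smult c p)"
    using le[of "inverse c" "smult c p"] False by simp
  then have "cmod c * disc_norm p \<le> cmod c * (cmod (inverse c) * disc_norm (smult c p))"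
    by (rule mult_left_mono) simp
  also have "\<dots> = disc_norm (smult c p)"
    using False by (simp add: norm_inverse)
  finally have "cmod c * disc_norm p \<le> disc_norm (smult c p)" .
  with le show ?thesis by (simp add: order_antisym)
qed (simp add: disc_norm_const[of 0, simplified])

lemma disc_norm_uminus: "disc_norm (- p) = disc_norm p"
  using disc_norm_smult[of "-1" p] by simp

lemma disc_norm_diff: "disc_norm (p - q) \<le> disc_norm p + disc_norm q"
  using disc_norm_add[of p "- q"] by (simp add: disc_norm_uminus)

lemma disc_norm_one: "disc_norm 1 = 1"
  using disc_norm_const[of 1] by (simp flip: one_pCons)

lemma disc_norm_power: "disc_norm (p ^ n) \<le> disc_norm p ^ n"
proof (induction n)
  case (Suc n)
  show ?case
    using order_trans[OF disc_norm_mult mult_left_mono[OF Suc disc_norm_nonneg]] by simp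
qed (simp add: disc_norm_one)

lemma disc_norm_sum: "disc_norm (\<Sum>a\<in>A. f a) \<le> (\<Sum>a\<in>A. disc_norm (f a))"
proof (induction A rule: infinite_finite_induct)
  case (insert a A)
  then show ?case using disc_norm_add[of "f a" "sum f A"] by simp
qed (use disc_norm_const[of 0] in auto)

text \<open>The point 1 lies in the disc. Order 0 is thus governed by the uniform norm, in contrast
  to the higher orders.\<close>

lemma taylor_0_le: "cmod (taylor 0 p) \<le> disc_norm p"
  by (simp add: taylor_0 disc_norm_upper)


section \<open>The algebra of polynomials\<close>

lemma poly_algebra_simps [simp]:
  "carrier poly_algebra = UNIV" "p \<otimes>\<^bsub>poly_algebra\<^esub> q = p * q" "\<one>\<^bsub>poly_algebra\<^esub> = 1"
  "\<zero>\<^bsub>poly_algebra\<^esub> = 0" "p \<oplus>\<^bsub>poly_algebra\<^esub> q = p + q" "c \<odot>\<^bsub>poly_algebra\<^esub> p = smult c p"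
  by (simp_all add: poly_algebra_def)

lemma algebra_poly_algebra: "Module.algebra complex_field poly_algebra"
proof (rule algebraI)
  show "cring (complex_field :: complex ring)" by (rule cring_from_type_algebra)
  show "cring poly_algebra"
  proof (rule cringI)
    show "abelian_group poly_algebra"
    proof (rule abelian_groupI)
      fix p assume "p \<in> carrier poly_algebra"
      show "\<exists>q\<in>carrier poly_algebra. q \<oplus>\<^bsub>poly_algebra\<^esub> p = \<zero>\<^bsub>poly_algebra\<^esub>"
        by (rule bexI[of _ "- p"]) simp_all
    qed (simp_all add: add_ac)
    show "comm_monoid poly_algebra" by (rule comm_monoidI) (simp_all add: mult_ac)
  qed (simp_all add: algebra_simps)
qed (simp_all add: smult_add_left smult_add_right)

lemma poly_algebra_uminus [simp]: "\<ominus>\<^bsub>poly_algebra\<^esub> p = - p"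
proof -
  interpret Module.algebra complex_field poly_algebra by (rule algebra_poly_algebra)
  show ?thesis by (rule minus_equality) simp_all
qed

lemma poly_algebra_minus [simp]: "p \<ominus>\<^bsub>poly_algebra\<^esub> q = p - q"
  by (simp add: a_minus_def)

lemma higher_point_derivation_taylor:
  "higher_point_derivation poly_algebra (\<lambda>p. poly p 1) taylor"
  unfolding higher_point_derivation_def
proof (intro conjI allI impI ballI)
  show "algebra_character poly_algebra (\<lambda>p. poly p 1)"
    by (auto simp: algebra_character_def linear_functional_def ring_hom_def)
  show "linear_functional poly_algebra (taylor i)" for i
    by (simp add: linear_functional_def taylor_add taylor_smult)
  fix s p q assume "1 \<le> (s :: nat)"
  then obtain r where s: "s = Suc r" by (cases s) auto
  have "taylor s (p * q) = taylor 0 p * taylor s q + (\<Sum>j = 1..s. taylor j p * taylor (s - j) q)"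
    unfolding taylor_mult atMost_atLeast0 by (simp add: sum.atLeast_Suc_atMost)
  also have "(\<Sum>j = 1..s. taylor j p * taylor (s - j) q) =
      (\<Sum>j = 1..s - 1. taylor j p * taylor (s - j) q) + taylor s p * taylor 0 q"
    unfolding s by simp
  finally show "taylor s (p \<otimes>\<^bsub>poly_algebra\<^esub> q) = poly p 1 * taylor s q + poly q 1 * taylor s p +
      (\<Sum>i = 1..s - 1. taylor i p * taylor (s - i) q)"
    by (simp add: taylor_0)
qed


section \<open>The metric of the higher point derivation\<close>

abbreviation deriv_length :: "complex poly \<Rightarrow> real" where
  "deriv_length \<equiv> derivation_length taylor"

text \<open>The sum is the l1 norm of the Taylor polynomial of order \<open>k\<close> at 1. Order 0
  is included so that this sum is submultiplicative by itself.\<close>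

definition disc_taylor_norm :: "nat \<Rightarrow> complex poly \<Rightarrow> real" where
  "disc_taylor_norm k p = disc_norm p + (\<Sum>i\<le>k. cmod (taylor i p))"

lemma submultiplicative_disc_taylor_norm:
  "submultiplicative_seminorm poly_algebra (disc_taylor_norm k)"
  unfolding submultiplicative_seminorm_def
proof (intro conjI ballI allI)
  let ?T = "\<lambda>p. \<Sum>i\<le>k. cmod (taylor i p)"
  have T0: "0 \<le> ?T p" for p by (intro sum_nonneg) simp
  fix p
  show "0 \<le> disc_taylor_norm k p"
    unfolding disc_taylor_norm_def by (intro add_nonneg_nonneg disc_norm_nonneg T0)
  show "disc_taylor_norm k (c \<odot>\<^bsub>poly_algebra\<^esub> p) = cmod c * disc_taylor_norm k p" for c
    by (simp add: disc_taylor_norm_def disc_norm_smult taylor_smult norm_mult distrib_left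
        sum_distrib_left)
  fix q
  have "?T (p + q) \<le> ?T p + ?T q"
    unfolding sum.distrib[symmetric] by (intro sum_mono) (simp add: taylor_add norm_triangle_ineq)
  then show "disc_taylor_norm k (p \<oplus>\<^bsub>poly_algebra\<^esub> q) \<le> disc_taylor_norm k p + disc_taylor_norm k q"
    using disc_norm_add[of p q] by (simp add: disc_taylor_norm_def)
  have "?T (p * q) \<le> (\<Sum>i\<le>k. \<Sum>j\<le>i. cmod (taylor j p) * cmod (taylor (i - j) q))"
    by (intro sum_mono) (simp add: taylor_mult norm_sum norm_mult flip: norm_mult)
  \<comment> \<open>The products that occur are those with i + j at most \<open>k\<close>; enlarging
    this triangle to the full square gives the product of the two sums.\<close>
  also have "\<dots> = (\<Sum>(i, j) | i + j \<le> k. cmod (taylor i p) * cmod (taylor j q))"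
    by (rule sum.triangle_reindex_eq[symmetric])
  also have "\<dots> \<le> (\<Sum>(i, j) \<in> {..k} \<times> {..k}. cmod (taylor i p) * cmod (taylor j q))"
    by (intro sum_mono2) auto
  also have "\<dots> = ?T p * ?T q"
    by (simp add: sum_product sum.cartesian_product)
  finally have "?T (p * q) \<le> ?T p * ?T q" .
  then have "disc_norm (p * q) + ?T (p * q) \<le> disc_norm p * disc_norm q + ?T p * ?T q"
    using disc_norm_mult[of p q] by simp
  also have "\<dots> \<le> (disc_norm p + ?T p) * (disc_norm q + ?T q)"
    using disc_norm_nonneg T0 by (simp add: algebra_simps)
  finally show "disc_taylor_norm k (p \<otimes>\<^bsub>poly_algebra\<^esub> q) \<le> disc_taylor_norm k p * disc_taylor_norm k q"
    by (simp add: disc_taylor_norm_def)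
qed

definition length_term :: "nat \<Rightarrow> complex poly \<Rightarrow> real" where
  "length_term i p = (1 / 2) ^ Suc i * (cmod (taylor (Suc i) p) / (1 + cmod (taylor (Suc i) p)))"

lemma length_term_nonneg: "0 \<le> length_term i p"
  by (simp add: length_term_def)

lemma length_term_le: "length_term i p \<le> (1 / 2) ^ Suc i"
proof -
  have "cmod (taylor (Suc i) p) / (1 + cmod (taylor (Suc i) p)) \<le> 1"
    by (rule divide_le_eq_1_pos[THEN iffD2, rotated]) (auto intro: add_pos_nonneg)
  then show ?thesis
    unfolding length_term_def by (intro mult_left_le) simp_all
qed

lemma length_term_le_taylor: "length_term i p \<le> cmod (taylor (Suc i) p)"
proof -
  let ?a = "cmod (taylor (Suc i) p)"
  have "(1 / 2 :: real) ^ Suc i * (?a / (1 + ?a)) \<le> 1 * (?a / 1)"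
    by (intro mult_mono divide_left_mono power_le_one) (auto intro: add_pos_nonneg)
  then show ?thesis by (simp add: length_term_def)
qed

lemma divide_one_plus_mono:
  fixes a b :: real
  assumes "0 \<le> a" "a \<le> b"
  shows "a / (1 + a) \<le> b / (1 + b)"
proof -
  have "x / (1 + x) = 1 - 1 / (1 + x)" if "0 \<le> x" for x :: real
    using that by (simp add: field_simps)
  moreover have "1 / (1 + b) \<le> 1 / (1 + a)"
    using assms by (intro divide_left_mono) simp_all
  ultimately show ?thesis using assms by simp
qed

text \<open>The function x / (1 + x) is increasing and subadditive on nonnegative reals, so it
  carries the triangle inequality over.\<close>

lemma length_term_add: "length_term i (p + q) \<le> length_term i p + length_term i q"
proof -
  have sub: "(a + b) / (1 + (a + b)) \<le> a / (1 + a) + b / (1 + b)" if "0 \<le> a" "0 \<le> b" for a b :: real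
  proof -
    have "a / (1 + (a + b)) \<le> a / (1 + a)" "b / (1 + (a + b)) \<le> b / (1 + b)"
      using that by (auto intro!: divide_left_mono)
    then show ?thesis by (simp add: add_divide_distrib)
  qed
  have "cmod (taylor (Suc i) (p + q)) / (1 + cmod (taylor (Suc i) (p + q))) \<le>
      cmod (taylor (Suc i) p) / (1 + cmod (taylor (Suc i) p)) +
      cmod (taylor (Suc i) q) / (1 + cmod (taylor (Suc i) q))"
    by (rule order_trans[OF divide_one_plus_mono sub]) (auto simp: taylor_add norm_triangle_ineq)
  then show ?thesis
    unfolding length_term_def distrib_left[symmetric] by (intro mult_left_mono) simp_all
qed

lemma summable_half_Suc: "summable (\<lambda>i. (1 / 2 :: real) ^ Suc i)"
  by (simp add: summable_geometric)

lemma summable_length_term: "summable (\<lambda>i. length_term i p)"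
  by (rule summable_comparison_test'[OF summable_half_Suc, of 0])
    (simp add: length_term_nonneg length_term_le del: power_Suc)

lemma deriv_length_eq: "deriv_length p = disc_norm p + (\<Sum>i. length_term i p)"
  by (simp add: derivation_length_def length_term_def)

lemma suminf_length_term_nonneg: "0 \<le> (\<Sum>i. length_term i p)"
  by (intro suminf_nonneg summable_length_term length_term_nonneg)

lemma length_term_le_deriv_length: "length_term i p \<le> deriv_length p"
proof -
  have "length_term i p = (\<Sum>j\<in>{i}. length_term j p)" by simp
  also have "\<dots> \<le> (\<Sum>j. length_term j p)"
    by (intro sum_le_suminf summable_length_term) (auto simp: length_term_nonneg)
  finally show ?thesis using disc_norm_nonneg[of p] by (simp add: deriv_length_eq)
qed

lemma deriv_length_add: "deriv_length (p + q) \<le> deriv_length p + deriv_length q"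
proof -
  have "(\<Sum>i. length_term i (p + q)) \<le> (\<Sum>i. length_term i p + length_term i q)"
    by (intro suminf_le length_term_add summable_add summable_length_term)
  also have "\<dots> = (\<Sum>i. length_term i p) + (\<Sum>i. length_term i q)"
    by (intro suminf_add[symmetric] summable_length_term)
  finally show ?thesis using disc_norm_add[of p q] by (simp add: deriv_length_eq)
qed

lemma disc_taylor_norm_small:
  assumes "0 < e"
  shows "\<exists>\<delta>>0. \<forall>p. deriv_length p < \<delta> \<longrightarrow> disc_taylor_norm k p < e"
proof -
  \<comment> \<open>The disc norm and the coefficients of orders 0 to \<open>k\<close> are
    \<open>k + 2\<close> quantities, each at most \<open>b\<close>; one further \<open>b\<close>
    makes the final bound strict.\<close>
  define b where "b = e / real (k + 3)"
  have b: "0 < b" using assms by (simp add: b_def)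
  \<comment> \<open>Every coefficient of order 1 to \<open>k\<close> enters the metric with weight
    at least \<open>(1 / 2) ^ Suc k\<close>. If one of them exceeded \<open>b\<close>, its term
    alone would be at least the second entry of the minimum.\<close>
  define \<delta> where "\<delta> = min b ((1 / 2) ^ Suc k * (b / (1 + b)))"
  have "disc_taylor_norm k p < e" if p: "deriv_length p < \<delta>" for p
  proof -
    have dn: "disc_norm p < b"
      using p suminf_length_term_nonneg[of p] by (simp add: \<delta>_def deriv_length_eq)
    have "cmod (taylor i p) \<le> b" if i: "i \<le> k" for i
    proof (cases i)
      \<comment> \<open>The series in the metric starts at order 1, so order 0 has to be bounded by
        the uniform norm.\<close>
      case 0
      then show ?thesis using taylor_0_le[of p] dn by simp
    next
      case (Suc j)
      show ?thesis
      proof (rule ccontr)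
        assume "\<not> ?thesis"
        then have "b / (1 + b) \<le> cmod (taylor i p) / (1 + cmod (taylor i p))"
          using b by (intro divide_one_plus_mono) simp_all
        moreover have "(1 / 2 :: real) ^ Suc k \<le> (1 / 2) ^ Suc j"
          using i Suc by (intro power_decreasing) auto
        ultimately have "(1 / 2) ^ Suc k * (b / (1 + b)) \<le> length_term j p"
          using b unfolding length_term_def Suc by (intro mult_mono) auto
        then show False using length_term_le_deriv_length[of j p] p by (simp add: \<delta>_def)
      qed
    qed
    then have "(\<Sum>i\<le>k. cmod (taylor i p)) \<le> (\<Sum>i\<le>k. b)" by (intro sum_mono) simp
    then have "disc_taylor_norm k p \<le> real (k + 2) * b"
      using dn by (simp add: disc_taylor_norm_def algebra_simps)
    also have "\<dots> < real (k + 3) * b" using b by simp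
    also have "\<dots> = e" by (simp add: b_def)
    finally show ?thesis .
  qed
  moreover have "0 < \<delta>" using b by (simp add: \<delta>_def)
  ultimately show ?thesis by blast
qed

text \<open>The first \<open>k\<close> terms of the series are at most the Taylor coefficients
  themselves; the remaining ones are bounded by the tail of the geometric series, which sums to
  \<open>(1 / 2) ^ k\<close>.\<close>

lemma deriv_length_le: "deriv_length p \<le> disc_taylor_norm k p + (1 / 2) ^ k"
proof -
  have "(\<Sum>i. length_term i p) = (\<Sum>i. length_term (i + k) p) + (\<Sum>i<k. length_term i p)"
    by (rule suminf_split_initial_segment[OF summable_length_term])
  moreover have "(\<Sum>i. length_term (i + k) p) \<le> (\<Sum>i. (1 / 2) ^ k * (1 / 2) ^ Suc i)"
    by (intro suminf_le summable_ignore_initial_segment summable_length_term summable_mult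
        summable_half_Suc order_trans[OF length_term_le]) (simp add: power_add)
  moreover have "(\<Sum>i. (1 / 2) ^ k * (1 / 2 :: real) ^ Suc i) = (1 / 2) ^ k"
    using sums_unique[OF sums_mult[OF power_half_series, of "(1 / 2) ^ k"]] by simp
  moreover have "(\<Sum>i<k. length_term i p) \<le> (\<Sum>i<k. cmod (taylor (Suc i) p))"
    by (intro sum_mono length_term_le_taylor)
  moreover have "(\<Sum>i<k. cmod (taylor (Suc i) p)) \<le> (\<Sum>i\<le>k. cmod (taylor i p))"
    unfolding lessThan_Suc_atMost[symmetric] sum.lessThan_Suc_shift by simp
  ultimately show ?thesis by (simp add: deriv_length_eq disc_taylor_norm_def)
qed

lemma deriv_length_small:
  assumes "0 < e"
  shows "\<exists>k. \<exists>\<delta>>0. \<forall>p. disc_taylor_norm k p < \<delta> \<longrightarrow> deriv_length p < e"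
proof -
  obtain k where "(1 / 2 :: real) ^ k < e / 2"
    using real_arch_pow_inv[of "e / 2" "1 / 2"] assms by auto
  then have "disc_taylor_norm k p < e / 2 \<longrightarrow> deriv_length p < e" for p
    using deriv_length_le[of p k] by auto
  then show ?thesis using assms by (intro exI[of _ k] exI[of _ "e / 2"]) auto
qed

interpretation D: seminormed_algebra poly_algebra deriv_length disc_taylor_norm
proof (intro seminormed_algebra.intro seminormed_algebra_axioms.intro)
  show "Module.algebra complex_field poly_algebra" by (rule algebra_poly_algebra)
  show "submultiplicative_seminorm poly_algebra (disc_taylor_norm k)" for k
    by (rule submultiplicative_disc_taylor_norm)
  show "disc_taylor_norm k p \<le> disc_taylor_norm (Suc k) p" for k p
    by (simp add: disc_taylor_norm_def)
  show "0 \<le> deriv_length p" for p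
    using disc_norm_nonneg[of p] suminf_length_term_nonneg[of p] by (simp add: deriv_length_eq)
  show "deriv_length (p \<oplus>\<^bsub>poly_algebra\<^esub> q) \<le> deriv_length p + deriv_length q" for p q
    by (simp add: deriv_length_add)
  show "deriv_length (\<ominus>\<^bsub>poly_algebra\<^esub> p) = deriv_length p" for p
    by (simp add: derivation_length_def disc_norm_uminus taylor_uminus)
qed (use disc_taylor_norm_small deriv_length_small in auto)

abbreviation cauchy :: "(nat \<Rightarrow> complex poly) set" where
  "cauchy \<equiv> cauchy_seqs poly_algebra deriv_length"

abbreviation null :: "(nat \<Rightarrow> complex poly) set" where
  "null \<equiv> null_seqs poly_algebra deriv_length"

lemma disc_norm_le_disc_taylor_norm: "disc_norm p \<le> disc_taylor_norm k p"
  by (simp add: disc_taylor_norm_def sum_nonneg)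

lemma taylor_le_disc_taylor_norm: "cmod (taylor k p) \<le> disc_taylor_norm k p"
proof -
  have "cmod (taylor k p) \<le> (\<Sum>i\<le>k. cmod (taylor i p))"
    by (rule member_le_sum) auto
  then show ?thesis using disc_norm_nonneg[of p] by (simp add: disc_taylor_norm_def)
qed

lemma null_iff:
  "s \<in> null \<longleftrightarrow> (\<lambda>n. disc_norm (s n)) \<longlonglongrightarrow> 0 \<and> (\<forall>i. (\<lambda>n. taylor i (s n)) \<longlonglongrightarrow> 0)"
proof
  assume "s \<in> null"
  then have *: "(\<lambda>n. disc_taylor_norm k (s n)) \<longlonglongrightarrow> 0" for k by (simp add: D.null_seqs_iff)
  have "(\<lambda>n. taylor i (s n)) \<longlonglongrightarrow> 0" for i
    by (rule Lim_null_comparison[OF always_eventually *[of i]]) (simp add: taylor_le_disc_taylor_norm)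
  moreover have "(\<lambda>n. disc_norm (s n)) \<longlonglongrightarrow> 0"
    by (rule tendsto_zero_le[OF *[of 0]]) (simp_all add: disc_norm_nonneg disc_norm_le_disc_taylor_norm)
  ultimately show "(\<lambda>n. disc_norm (s n)) \<longlonglongrightarrow> 0 \<and> (\<forall>i. (\<lambda>n. taylor i (s n)) \<longlonglongrightarrow> 0)"
    by simp
next
  assume *: "(\<lambda>n. disc_norm (s n)) \<longlonglongrightarrow> 0 \<and> (\<forall>i. (\<lambda>n. taylor i (s n)) \<longlonglongrightarrow> 0)"
  have "(\<lambda>n. disc_norm (s n) + (\<Sum>i\<le>k. cmod (taylor i (s n)))) \<longlonglongrightarrow> 0 + (\<Sum>i\<le>k. 0)" for k
    using * by (intro tendsto_add tendsto_sum tendsto_norm_zero) auto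
  then show "s \<in> null" by (simp add: D.null_seqs_iff disc_taylor_norm_def)
qed

lemma convergent_taylor:
  assumes "s \<in> cauchy"
  shows "convergent (\<lambda>n. taylor i (s n))"
  using assms
  by (intro Cauchy_double_limit[of "\<lambda>m n. disc_taylor_norm i (s m - s n)"])
    (auto simp: D.cauchy_seqs_iff taylor_le_disc_taylor_norm simp flip: taylor_diff)

lemma bounded_disc_norm:
  assumes "s \<in> cauchy"
  obtains B where "0 \<le> B" "\<And>n. disc_norm (s n) \<le> B"
proof -
  obtain B where "0 \<le> B" "\<And>n. disc_taylor_norm 0 (s n) \<le> B"
    using D.cauchy_bounded_Q[OF assms] by blast
  then show ?thesis using that disc_norm_le_disc_taylor_norm order_trans by blast
qed

text \<open>The sequences built below converge uniformly to a polynomial, to 1 or to 0, so the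
  uniform part is stated with its limit \<open>c\<close>. The limits of the Taylor coefficients may
  differ from the coefficients of \<open>c\<close>, which is what lets a sequence with uniform limit
  0 represent a nonzero element.\<close>

lemma cauchyI:
  assumes L: "(\<lambda>n. disc_norm (s n - c)) \<longlonglongrightarrow> 0" and T: "\<And>i. convergent (\<lambda>n. taylor i (s n))"
  shows "s \<in> cauchy"
  unfolding D.cauchy_seqs_iff
proof (intro conjI allI)
  fix k
  have T': "((\<lambda>x. cmod (taylor i (s (fst x)) - taylor i (s (snd x)))) \<longlongrightarrow> 0) double_limit" for i
  proof -
    obtain l where l: "(\<lambda>n. taylor i (s n)) \<longlonglongrightarrow> l" using T by (auto simp: convergent_def)
    have "((\<lambda>x. taylor i (s (fst x)) - taylor i (s (snd x))) \<longlongrightarrow> l - l) double_limit"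
      by (intro tendsto_diff filterlim_compose[OF l] filterlim_fst filterlim_snd)
    then show ?thesis by (intro tendsto_norm_zero) simp
  qed
  have lim: "((\<lambda>x. (disc_norm (s (fst x) - c) + disc_norm (s (snd x) - c)) +
      (\<Sum>i\<le>k. cmod (taylor i (s (fst x)) - taylor i (s (snd x))))) \<longlongrightarrow> (0 + 0) + (\<Sum>i\<le>k. 0)) double_limit"
    by (intro tendsto_add tendsto_sum T' filterlim_compose[OF L] filterlim_fst filterlim_snd)
  have le: "disc_taylor_norm k (p - q) \<le> (disc_norm (p - c) + disc_norm (q - c)) +
      (\<Sum>i\<le>k. cmod (taylor i p - taylor i q))" for p q
    using disc_norm_diff[of "p - c" "q - c"] by (simp add: disc_taylor_norm_def taylor_diff)
  show "((\<lambda>x. disc_taylor_norm k (s (fst x) \<ominus>\<^bsub>poly_algebra\<^esub> s (snd x))) \<longlongrightarrow> 0) double_limit"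
    by (rule tendsto_zero_le[OF lim]) (simp_all add: D.Q_nonneg le)
qed simp

lemma cauchy_power:
  assumes "s \<in> cauchy"
  shows "(\<lambda>n. s n ^ j) \<in> cauchy"
proof (induction j)
  case 0
  show ?case using D.cauchy_const[of 1] by simp
next
  case (Suc j)
  show ?case using D.cauchy_mult[OF assms Suc] by simp
qed

text \<open>The bound 2 reproduces itself when the sum is written as 1 plus \<open>u\<close> times a
  shorter sum, because 1 + (1/2) * 2 = 2.\<close>

lemma disc_norm_geometric_sum:
  assumes "disc_norm u \<le> 1 / 2"
  shows "disc_norm (\<Sum>j<n. u ^ j) \<le> 2"
proof (induction n)
  case (Suc n)
  have "(\<Sum>j<Suc n. u ^ j) = 1 + u * (\<Sum>j<n. u ^ j)"
    by (simp only: sum.lessThan_Suc_shift sum_distrib_left power_Suc power_0)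
  then have "disc_norm (\<Sum>j<Suc n. u ^ j) \<le> 1 + disc_norm u * disc_norm (\<Sum>j<n. u ^ j)"
    using disc_norm_add[of 1 "u * (\<Sum>j<n. u ^ j)"] disc_norm_mult[of u "\<Sum>j<n. u ^ j"]
    by (simp add: disc_norm_one)
  also have "\<dots> \<le> 1 + (1 / 2) * 2"
    by (intro add_left_mono mult_mono assms Suc disc_norm_nonneg) simp
  finally show ?case by simp
qed (use disc_norm_const[of 0] in simp)

text \<open>Subtracting the constants \<open>u n (1)\<close> makes \<open>u n\<close> vanish at 1, so that \<open>u n ^ j\<close> contributes
  to the Taylor coefficients of order at least \<open>j\<close> only, and the partial sums of the geometric
  series converge in every coefficient.\<close>

lemma one_minus_invertible:
  assumes s: "s \<in> cauchy" and s0: "(\<lambda>n. disc_norm (s n)) \<longlonglongrightarrow> 0"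
  shows "\<exists>t\<in>cauchy. (\<lambda>n. (1 - s n) * t n - 1) \<in> null"
proof -
  define c where "c n = [:taylor 0 (s n):]" for n
  define u where "u n = s n - c n" for n
  \<comment> \<open>The number of terms grows with \<open>n\<close>, so that the remainder
    \<open>u n ^ Suc n\<close> vanishes at 1 to an order that tends to infinity and is a null
    sequence.\<close>
  define t where "t n = (\<Sum>j<Suc n. u n ^ j)" for n
  have c: "disc_norm (c n) \<le> disc_norm (s n)" for n
    by (simp add: c_def disc_norm_const taylor_0_le)
  have c0: "(\<lambda>n. disc_norm (c n)) \<longlonglongrightarrow> 0"
    by (rule tendsto_zero_le[OF s0]) (simp_all add: c disc_norm_nonneg)
  then have "(\<lambda>n. cmod (taylor 0 (s n))) \<longlonglongrightarrow> 0" by (simp add: c_def disc_norm_const)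
  then have "(\<lambda>n. taylor i (c n)) \<longlonglongrightarrow> 0" for i
    by (cases "i = 0") (simp_all add: c_def taylor_const tendsto_norm_zero_iff)
  then have c_null: "c \<in> null" using c0 by (simp add: null_iff)
  have u: "u \<in> cauchy"
    unfolding u_def[abs_def] using D.cauchy_minus[OF s D.null_imp_cauchy[OF c_null]] by simp
  have u_zero: "taylor 0 (u n) = 0" for n
    by (simp add: u_def c_def taylor_diff taylor_const)
  have "(\<lambda>n. disc_norm (s n) + disc_norm (c n)) \<longlonglongrightarrow> 0 + 0" by (intro tendsto_add s0 c0)
  then have u0: "(\<lambda>n. disc_norm (u n)) \<longlonglongrightarrow> 0"
    by (rule tendsto_zero_le) (simp_all add: u_def disc_norm_diff disc_norm_nonneg)
  have u_small: "\<forall>\<^sub>F n in sequentially. disc_norm (u n) < 1 / 2"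
    using u0 by (rule order_tendstoD) simp
  have t: "t \<in> cauchy"
  proof (rule cauchyI[of _ 1])
    have "\<forall>\<^sub>F n in sequentially. norm (disc_norm (t n - 1)) \<le> 2 * disc_norm (u n)"
      using u_small
    proof eventually_elim
      case (elim n)
      have "t n - 1 = u n * (\<Sum>j<n. u n ^ j)"
        by (simp only: t_def sum.lessThan_Suc_shift sum_distrib_left power_Suc power_0 add_diff_cancel_left')
      then have "disc_norm (t n - 1) \<le> disc_norm (u n) * disc_norm (\<Sum>j<n. u n ^ j)"
        by (simp add: disc_norm_mult)
      also have "\<dots> \<le> disc_norm (u n) * 2"
        using elim by (intro mult_left_mono disc_norm_geometric_sum disc_norm_nonneg) simp
      finally show ?case by (simp add: disc_norm_nonneg)
    qed
    moreover have "(\<lambda>n. 2 * disc_norm (u n)) \<longlonglongrightarrow> 0"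
      using tendsto_mult_right_zero[OF u0] .
    ultimately show "(\<lambda>n. disc_norm (t n - 1)) \<longlonglongrightarrow> 0" by (rule Lim_null_comparison)
  next
    fix i
    have "\<forall>\<^sub>F n in sequentially. taylor i (t n) = (\<Sum>j\<le>i. taylor i (u n ^ j))"
      using eventually_ge_at_top[of i]
    proof eventually_elim
      case (elim n)
      have "(\<Sum>j\<in>{..<Suc n}. taylor i (u n ^ j)) = (\<Sum>j\<le>i. taylor i (u n ^ j))"
        using elim by (intro sum.mono_neutral_right) (auto intro: taylor_power_eq_0 u_zero)
      then show ?case by (simp only: t_def taylor_sum)
    qed
    moreover have "convergent (\<lambda>n. \<Sum>j\<le>i. taylor i (u n ^ j))"
      by (intro convergent_sum convergent_taylor cauchy_power u)
    ultimately show "convergent (\<lambda>n. taylor i (t n))"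
      by (simp add: convergent_cong)
  qed
  have pow: "(\<lambda>n. u n ^ Suc n) \<in> null"
    unfolding null_iff
  proof (intro conjI allI)
    have "\<forall>\<^sub>F n in sequentially. norm (disc_norm (u n ^ Suc n)) \<le> disc_norm (u n)"
      using u_small
    proof eventually_elim
      case (elim n)
      have "disc_norm (u n ^ Suc n) \<le> disc_norm (u n) ^ Suc n" by (rule disc_norm_power)
      also have "\<dots> \<le> disc_norm (u n) ^ 1"
        using elim disc_norm_nonneg[of "u n"] by (intro power_decreasing) auto
      finally show ?case by (simp add: disc_norm_nonneg)
    qed
    then show "(\<lambda>n. disc_norm (u n ^ Suc n)) \<longlonglongrightarrow> 0" using u0 by (rule Lim_null_comparison)
    show "(\<lambda>n. taylor i (u n ^ Suc n)) \<longlonglongrightarrow> 0" for i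
    proof (rule tendsto_eventually)
      show "\<forall>\<^sub>F n in sequentially. taylor i (u n ^ Suc n) = 0"
        using eventually_ge_at_top[of i] by eventually_elim (rule taylor_power_eq_0[OF u_zero], simp)
    qed
  qed
  \<comment> \<open>Here \<open>1 - s n\<close> is \<open>(1 - u n) - c n\<close>: the first part
    telescopes against the geometric sum, the second leaves a multiple of the null sequence
    \<open>c\<close>.\<close>
  have "(1 - s n) * t n - 1 = - (t n * c n + u n ^ Suc n)" for n
  proof -
    have "(1 - u n) * t n = 1 - u n ^ Suc n"
      unfolding t_def by (rule one_diff_power_eq[symmetric])
    then show ?thesis by (simp add: u_def algebra_simps)
  qed
  moreover have "(\<lambda>n. - (t n * c n + u n ^ Suc n)) \<in> null"
    using D.null_uminus[OF D.null_add[OF D.null_mult[OF t c_null] pow]] by simp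
  ultimately show ?thesis using t by (intro bexI[of _ t]) simp_all
qed


section \<open>The radical\<close>

interpretation A_D: Module.algebra complex_field A_D
  by (rule D.algebra_completion)

text \<open>This is the kernel of the homomorphism from \<open>A_D\<close> to the disc algebra that
  extends the inclusion of the polynomials.\<close>

definition disc_null_ideal :: "(nat \<Rightarrow> complex poly) set set" where
  "disc_null_ideal = D.seq_class ` {s \<in> cauchy. (\<lambda>n. disc_norm (s n)) \<longlonglongrightarrow> 0}"

lemma disc_null_ideal_carrier: "x \<in> disc_null_ideal \<Longrightarrow> x \<in> carrier A_D"
  by (auto simp: disc_null_ideal_def intro: D.seq_class_closed)

lemma disc_null_ideal_mult:
  assumes "y \<in> carrier A_D" "x \<in> disc_null_ideal"
  shows "y \<otimes>\<^bsub>A_D\<^esub> x \<in> disc_null_ideal"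
proof -
  obtain s where s: "s \<in> cauchy" "(\<lambda>n. disc_norm (s n)) \<longlonglongrightarrow> 0" and x: "x = D.seq_class s"
    using assms(2) by (auto simp: disc_null_ideal_def)
  obtain r where r: "r \<in> cauchy" and y: "y = D.seq_class r"
    using assms(1) unfolding D.carrier_completion by blast
  obtain B where B: "0 \<le> B" "\<And>n. disc_norm (r n) \<le> B" using bounded_disc_norm[OF r] by blast
  have rs: "(\<lambda>n. r n * s n) \<in> cauchy" using D.cauchy_mult[OF r s(1)] by simp
  have lim: "(\<lambda>n. B * disc_norm (s n)) \<longlonglongrightarrow> 0" by (rule tendsto_mult_right_zero[OF s(2)])
  have le: "disc_norm (r n * s n) \<le> B * disc_norm (s n)" for n
    by (rule order_trans[OF disc_norm_mult]) (intro mult_right_mono B disc_norm_nonneg)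
  have "(\<lambda>n. disc_norm (r n * s n)) \<longlonglongrightarrow> 0"
    by (rule tendsto_zero_le[OF lim]) (simp_all add: disc_norm_nonneg le)
  with rs show ?thesis
    unfolding x y D.completion_mult[OF r s(1)] disc_null_ideal_def by auto
qed

text \<open>Write c - x as c (1 - x/c). A representative of x/c still tends to 0 uniformly, so
  \<open>one_minus_invertible\<close> applies, and its inverse divided by \<open>c\<close> is the
  inverse sought.\<close>

lemma smult_one_minus_Units:
  assumes "x \<in> disc_null_ideal" and c: "c \<noteq> 0"
  shows "(c \<odot>\<^bsub>A_D\<^esub> \<one>\<^bsub>A_D\<^esub>) \<ominus>\<^bsub>A_D\<^esub> x \<in> Units A_D"
proof -
  obtain s where s: "s \<in> cauchy" "(\<lambda>n. disc_norm (s n)) \<longlonglongrightarrow> 0" and x: "x = D.seq_class s"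
    using assms(1) by (auto simp: disc_null_ideal_def)
  have "(\<lambda>n. smult (1 / c) (s n)) \<in> cauchy" using D.cauchy_smult[OF s(1)] by simp
  moreover have "(\<lambda>n. disc_norm (smult (1 / c) (s n))) \<longlonglongrightarrow> 0"
    unfolding disc_norm_smult by (rule tendsto_mult_right_zero[OF s(2)])
  ultimately obtain t where t: "t \<in> cauchy" "(\<lambda>n. (1 - smult (1 / c) (s n)) * t n - 1) \<in> null"
    using one_minus_invertible by blast
  define t' where "t' n = smult (1 / c) (t n)" for n
  have t': "t' \<in> cauchy" unfolding t'_def[abs_def] using D.cauchy_smult[OF t(1)] by simp
  have one: "(\<lambda>n. 1) \<in> cauchy" using D.cauchy_const[of 1] by simp
  have c1: "(\<lambda>n. smult c 1) \<in> cauchy" using D.cauchy_const[of "smult c 1"] by simp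
  have cs: "(\<lambda>n. smult c 1 - s n) \<in> cauchy" using D.cauchy_minus[OF c1 s(1)] by simp
  have eq: "c \<odot>\<^bsub>A_D\<^esub> \<one>\<^bsub>A_D\<^esub> \<ominus>\<^bsub>A_D\<^esub> x = D.seq_class (\<lambda>n. smult c 1 - s n)"
    using D.completion_smult[OF one, of c] D.completion_minus[OF c1 s(1)]
    by (simp add: D.completion_one x)
  have "(smult c 1 - s n) * t' n = (1 - smult (1 / c) (s n)) * t n" for n
  proof -
    have "smult c 1 - s n = smult c (1 - smult (1 / c) (s n))"
      using c by (simp add: smult_diff_right)
    then show ?thesis using c by (simp add: t'_def)
  qed
  then have "(\<lambda>n. (smult c 1 - s n) * t' n - 1) \<in> null" using t(2) by simp
  then have "D.seq_class (\<lambda>n. smult c 1 - s n) \<otimes>\<^bsub>A_D\<^esub> D.seq_class t' = \<one>\<^bsub>A_D\<^esub>"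
    using D.seq_class_eq_iff[OF D.cauchy_mult[OF cs t'] one] D.completion_mult[OF cs t']
    by (simp add: D.completion_one)
  moreover from this have "D.seq_class t' \<otimes>\<^bsub>A_D\<^esub> D.seq_class (\<lambda>n. smult c 1 - s n) = \<one>\<^bsub>A_D\<^esub>"
    using A_D.m_comm[OF D.seq_class_closed[OF cs] D.seq_class_closed[OF t']] by simp
  ultimately show ?thesis
    unfolding eq Units_def using D.seq_class_closed[OF cs] D.seq_class_closed[OF t'] by blast
qed

lemma spectrum_disc_null_ideal: "x \<in> disc_null_ideal \<Longrightarrow> spectrum A_D x \<subseteq> {0}"
  using smult_one_minus_Units by (auto simp: spectrum_def)

text \<open>If \<open>x\<close> lay outside a maximal ideal \<open>J\<close>, it would be invertible
  modulo \<open>J\<close>. Some 1 - y x would then be a unit inside \<open>J\<close>.\<close>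

lemma jacobson_radicalI:
  fixes B :: "('s, 'a) module" (structure)
  assumes "cring B" and x: "x \<in> carrier B"
    and units: "\<And>y. y \<in> carrier B \<Longrightarrow> \<one> \<ominus> y \<otimes> x \<in> Units B"
  shows "x \<in> jacobson_radical B"
  unfolding jacobson_radical_def
proof (intro CollectI conjI allI impI x)
  interpret cring B by fact
  fix J assume J: "maximalideal J B"
  interpret J: maximalideal J B by fact
  interpret F: field "B Quot J" by (rule J.quotient_is_field) (rule is_cring)
  show "x \<in> J"
  proof (rule ccontr)
    assume "x \<notin> J"
    then have "J +> x \<noteq> J" using J.a_rcos_self[OF x] by auto
    moreover have "J +> x \<in> carrier (B Quot J)"
      unfolding FactRing_def partial_object.simps by (rule a_rcosetsI[OF J.a_subset x])
    moreover have "\<zero>\<^bsub>B Quot J\<^esub> = J" by (simp add: FactRing_def)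
    ultimately have "J +> x \<in> Units (B Quot J)"
      unfolding F.field_Units by simp
    then obtain C where C: "C \<in> carrier (B Quot J)" "C \<otimes>\<^bsub>B Quot J\<^esub> (J +> x) = \<one>\<^bsub>B Quot J\<^esub>"
      by (auto simp: Units_def)
    then obtain y where y: "y \<in> carrier B" "C = J +> y"
      by (auto simp: FactRing_simps)
    have "J +> (y \<otimes> x) = J +> \<one>"
      using C x y by (simp add: FactRing_def J.rcoset_mult_add)
    then have "\<one> \<ominus> y \<otimes> x \<in> J"
      using coset_eq_iff[OF J.is_ideal, of \<one> "y \<otimes> x"] x y by simp
    moreover obtain z where "z \<in> carrier B" "z \<otimes> (\<one> \<ominus> y \<otimes> x) = \<one>"
      using units[OF y(1)] by (auto simp: Units_def)
    ultimately have "\<one> \<in> J" using J.I_l_closed by metis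
    then show False using J.one_imp_carrier J.I_notcarr by simp
  qed
qed

lemma disc_null_ideal_subset_jacobson_radical: "disc_null_ideal \<subseteq> jacobson_radical A_D"
proof
  fix x assume x: "x \<in> disc_null_ideal"
  show "x \<in> jacobson_radical A_D"
  proof (rule jacobson_radicalI)
    fix y assume "y \<in> carrier A_D"
    then have "y \<otimes>\<^bsub>A_D\<^esub> x \<in> disc_null_ideal" using x by (rule disc_null_ideal_mult)
    then show "\<one>\<^bsub>A_D\<^esub> \<ominus>\<^bsub>A_D\<^esub> y \<otimes>\<^bsub>A_D\<^esub> x \<in> Units A_D"
      using smult_one_minus_Units[of "y \<otimes>\<^bsub>A_D\<^esub> x" 1] A_D.smult_one[OF A_D.one_closed] by simp
  qed (simp_all add: A_D.M_cring disc_null_ideal_carrier x)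
qed

lemma A_D_power:
  fixes n :: nat
  assumes "s \<in> cauchy"
  shows "D.seq_class s [^]\<^bsub>A_D\<^esub> n = D.seq_class (\<lambda>k. s k ^ n)"
proof (induction n)
  case 0
  show ?case by (simp add: D.completion_one)
next
  case (Suc n)
  then show ?case
    using D.completion_mult[OF cauchy_power[OF assms, of n] assms] by (simp add: mult.commute)
qed


section \<open>A non-nilpotent element of the radical\<close>

text \<open>With \<open>w = z ^ m\<close>, truncating the series of \<open>log w / m = log z\<close> at order \<open>k\<close> gives
  polynomials whose first \<open>k\<close> Taylor coefficients at 1 are those of \<open>log z\<close>, while the
  disc norm is at most \<open>2 ^ Suc k / m\<close>.\<close>

definition log_poly :: "nat \<Rightarrow> nat \<Rightarrow> complex poly" where
  "log_poly k m = smult (1 / of_nat m)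
    (\<Sum>j<k. smult ((- 1) ^ j / of_nat (Suc j)) ((monom 1 m - 1) ^ Suc j))"

text \<open>The operator z d/dz sends z^m to m z^m, so the factor 1/m cancels and a geometric sum in
  1 - z^m remains. For log z itself the result would be exactly 1; the error (1 - z^m)^k vanishes at
  1 to order \<open>k\<close>.\<close>

lemma log_poly_pderiv:
  assumes "m > 0"
  shows "[:0, 1:] * pderiv (log_poly k m) = 1 - (1 - monom 1 m) ^ k"
proof -
  let ?w = "monom 1 m :: complex poly"
  have dw: "[:0, 1:] * pderiv ?w = smult (of_nat m) ?w"
    using assms by (cases m) (simp_all add: pderiv_monom smult_monom flip: monom_Suc)
  have "[:0, 1:] * pderiv (smult ((- 1) ^ j / of_nat (Suc j)) ((?w - 1) ^ Suc j)) =
      smult (of_nat m) (?w * (1 - ?w) ^ j)" for j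
  proof -
    have "(?w - 1) ^ j = smult ((- 1) ^ j) ((1 - ?w) ^ j)"
    proof -
      have "?w - 1 = smult (- 1) (1 - ?w)" by simp
      then show ?thesis by (simp only: smult_power)
    qed
    moreover have "(- 1) ^ j * (- 1) ^ j = (1 :: complex)"
      by (simp flip: power_mult_distrib)
    ultimately have "smult ((- 1) ^ j) ((?w - 1) ^ j) = (1 - ?w) ^ j" by simp
    moreover have "pderiv (smult ((- 1) ^ j / of_nat (Suc j)) ((?w - 1) ^ Suc j)) =
        smult ((- 1) ^ j) ((?w - 1) ^ j) * pderiv ?w"
      by (simp add: pderiv_smult pderiv_power_Suc pderiv_diff del: of_nat_Suc power_Suc)
    ultimately have "[:0, 1:] * pderiv (smult ((- 1) ^ j / of_nat (Suc j)) ((?w - 1) ^ Suc j)) =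
        (1 - ?w) ^ j * ([:0, 1:] * pderiv ?w)"
      by (simp only: mult_ac)
    then show ?thesis unfolding dw by (simp add: mult.commute)
  qed
  then have "[:0, 1:] * pderiv (log_poly k m) =
      smult (1 / of_nat m) (\<Sum>j<k. smult (of_nat m) (?w * (1 - ?w) ^ j))"
    by (simp only: log_poly_def pderiv_smult higher_pderiv_sum[of 1, simplified] mult_smult_right sum_distrib_left)
  also have "\<dots> = (1 - (1 - ?w)) * (\<Sum>j<k. (1 - ?w) ^ j)"
  proof -
    have "smult b (\<Sum>j<k. smult c (f j)) = smult (b * c) (\<Sum>j<k. f j)" for b c :: complex and f
      by (induction k) (simp_all add: smult_add_right)
    then show ?thesis using assms by (simp add: sum_distrib_left)
  qed
  also have "\<dots> = 1 - (1 - ?w) ^ k" by (rule one_diff_power_eq[symmetric])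
  finally show ?thesis .
qed

lemma taylor_0_log_poly: "taylor 0 (log_poly k m) = 0"
  by (simp add: taylor_0 log_poly_def poly_sum poly_monom)

text \<open>Comparing coefficients in \<open>log_poly_pderiv\<close> below order \<open>k\<close>
  gives a recursion in which neither \<open>k\<close> nor \<open>m\<close> occurs: the first
  coefficient is 1, and order times coefficient changes sign at each step.\<close>

lemma taylor_log_poly:
  assumes "m > 0" "i < k"
  shows "taylor (Suc i) (log_poly k m) = (- 1) ^ i / of_nat (Suc i)"
  using assms(2)
proof (induction i)
  case 0
  have "taylor 0 [:0, 1:] = 1" by (simp add: taylor_0)
  then have "taylor 0 ([:0, 1:] * pderiv (log_poly k m)) = taylor 1 (log_poly k m)"
    unfolding taylor_mult by (simp add: taylor_pderiv)
  moreover have "taylor 0 (1 - (1 - monom 1 m) ^ k) = 1"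
    using 0 by (simp add: taylor_0 poly_monom poly_power)
  ultimately show ?case using log_poly_pderiv[OF assms(1), of k] by simp
next
  case (Suc i)
  have z: "taylor 0 (1 - monom 1 m) = 0" by (simp add: taylor_0 poly_monom)
  have "taylor (Suc i) (1 - (1 - monom 1 m) ^ k) = 0"
    using taylor_power_eq_0[OF z Suc.prems] by (simp add: taylor_diff taylor_one)
  then have "of_nat (Suc (Suc i)) * taylor (Suc (Suc i)) (log_poly k m) +
      of_nat (Suc i) * taylor (Suc i) (log_poly k m) = 0"
    unfolding log_poly_pderiv[OF assms(1), symmetric] taylor_X_mult_Suc taylor_pderiv .
  moreover have "of_nat (Suc i) * taylor (Suc i) (log_poly k m) = (- 1) ^ i"
    using Suc by (simp del: of_nat_Suc)
  ultimately have "of_nat (Suc (Suc i)) * taylor (Suc (Suc i)) (log_poly k m) = (- 1) ^ Suc i"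
    by (simp add: eq_neg_iff_add_eq_0)
  then show ?case
    by (metis nonzero_mult_div_cancel_left of_nat_eq_0_iff nat.distinct(1))
qed

text \<open>On the disc z^m - 1 is bounded by 2 for every m, so the sum is bounded by a constant
  that depends on \<open>k\<close> only, and the prefactor 1/m is free to beat it.\<close>

lemma disc_norm_log_poly: "disc_norm (log_poly k m) \<le> 2 ^ Suc k / real m"
proof -
  let ?w = "monom 1 m :: complex poly"
  have "disc_norm ?w \<le> 1"
    by (rule disc_norm_least) (simp add: poly_monom norm_power power_le_one)
  then have w: "disc_norm (?w - 1) \<le> 2"
    using disc_norm_diff[of ?w 1] by (simp add: disc_norm_one)
  have "disc_norm (smult ((- 1) ^ j / of_nat (Suc j)) ((?w - 1) ^ Suc j)) \<le> 2 ^ Suc j" for j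
  proof -
    have "disc_norm (smult ((- 1) ^ j / of_nat (Suc j)) ((?w - 1) ^ Suc j)) =
        disc_norm ((?w - 1) ^ Suc j) / real (Suc j)"
      by (simp add: disc_norm_smult norm_divide norm_power norm_of_nat del: of_nat_Suc power_Suc)
    also have "\<dots> \<le> disc_norm ((?w - 1) ^ Suc j) / 1"
      by (intro divide_left_mono disc_norm_nonneg) simp_all
    also have "\<dots> \<le> 2 ^ Suc j"
      using order_trans[OF disc_norm_power power_mono[OF w disc_norm_nonneg]] by (simp del: power_Suc)
    finally show ?thesis .
  qed
  then have "disc_norm (\<Sum>j<k. smult ((- 1) ^ j / of_nat (Suc j)) ((?w - 1) ^ Suc j)) \<le> (\<Sum>j<k. 2 ^ Suc j)"
    by (intro order_trans[OF disc_norm_sum] sum_mono)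
  also have "(\<Sum>j<k. 2 ^ Suc j :: real) \<le> 2 ^ Suc k" by (induction k) simp_all
  finally show ?thesis
    by (simp add: log_poly_def disc_norm_smult norm_divide divide_right_mono del: power_Suc of_nat_Suc)
qed

text \<open>The exponent is chosen so that the bound \<open>2 ^ Suc k / m\<close> becomes
  \<open>1 / Suc k\<close>.\<close>

definition log_seq :: "nat \<Rightarrow> complex poly" where
  "log_seq k = log_poly k (2 ^ Suc k * Suc k)"

lemma taylor_log_seq_Suc: "i < k \<Longrightarrow> taylor (Suc i) (log_seq k) = (- 1) ^ i / of_nat (Suc i)"
  unfolding log_seq_def by (rule taylor_log_poly) simp_all

lemma log_seq_null_disc_norm: "(\<lambda>k. disc_norm (log_seq k)) \<longlonglongrightarrow> 0"
proof (rule tendsto_zero_le)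
  show "(\<lambda>k. 1 / real (Suc k)) \<longlonglongrightarrow> 0" using LIMSEQ_Suc[OF lim_1_over_n] .
  show "disc_norm (log_seq k) \<le> 1 / real (Suc k)" for k
    using disc_norm_log_poly[of k "2 ^ Suc k * Suc k"]
    by (simp add: log_seq_def del: of_nat_Suc power_Suc mult_Suc_right)
qed (simp_all add: disc_norm_nonneg)

lemma log_seq_cauchy: "log_seq \<in> cauchy"
proof (rule cauchyI[of _ 0])
  show "(\<lambda>n. disc_norm (log_seq n - 0)) \<longlonglongrightarrow> 0" using log_seq_null_disc_norm by simp
  show "convergent (\<lambda>n. taylor i (log_seq n))" for i
  proof (cases i)
    case 0
    then show ?thesis by (simp add: log_seq_def taylor_0_log_poly convergent_const)
  next
    case (Suc j)
    \<comment> \<open>Each coefficient is eventually constant, because the exponent that varies with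
      \<open>n\<close> does not affect it.\<close>
    have "\<forall>\<^sub>F n in sequentially. taylor i (log_seq n) = (- 1) ^ j / of_nat (Suc j)"
      using eventually_gt_at_top[of j] unfolding Suc
      by eventually_elim (rule taylor_log_seq_Suc)
    then show ?thesis by (auto simp: convergent_def intro: tendsto_eventually)
  qed
qed

lemma log_seq_not_nilpotent: "\<not> nilpotent A_D (D.seq_class log_seq)"
proof
  assume "nilpotent A_D (D.seq_class log_seq)"
  then obtain n :: nat where "D.seq_class log_seq [^]\<^bsub>A_D\<^esub> n = \<zero>\<^bsub>A_D\<^esub>"
    by (auto simp: nilpotent_def)
  then have "D.seq_class (\<lambda>k. log_seq k ^ n) = D.seq_class (\<lambda>k. 0)"
    by (simp add: A_D_power log_seq_cauchy D.completion_zero)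
  then have "(\<lambda>k. log_seq k ^ n) \<in> null"
    using D.seq_class_eq_iff[OF cauchy_power[OF log_seq_cauchy, of n] D.cauchy_const[of 0]] by simp
  then have "(\<lambda>k. taylor n (log_seq k ^ n)) \<longlonglongrightarrow> 0" by (simp add: null_iff)
  \<comment> \<open>For positive \<open>k\<close> the first coefficient of \<open>log_seq k\<close>
    is that of log z, namely 1, and so is each of its powers. The case of exponent 0 is covered too,
    so the argument also rules out that \<open>A_D\<close> is the zero ring.\<close>
  moreover have "\<forall>\<^sub>F k in sequentially. taylor n (log_seq k ^ n) = 1"
    using eventually_gt_at_top[of 0]
  proof eventually_elim
    case (elim k)
    have "taylor 0 (log_seq k) = 0" by (simp add: log_seq_def taylor_0_log_poly)
    then show ?case using taylor_log_seq_Suc[OF elim] by (simp add: taylor_power_same)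
  qed
  then have "(\<lambda>k. taylor n (log_seq k ^ n)) \<longlonglongrightarrow> 1" by (rule tendsto_eventually)
  ultimately show False using LIMSEQ_unique by fastforce
qed

theorem mainTheorem2:
  shows "higher_point_derivation poly_algebra (\<lambda>p. poly p 1) taylor_functional \<and>
    (\<exists>P. frechet_algebra A_D A_D_topology P) \<and>
    (\<forall>P. frechet_algebra A_D A_D_topology P \<longrightarrow>
      (\<exists>x \<in> jacobson_radical A_D. quasinilpotent A_D P x \<and> \<not> nilpotent A_D x))"
proof (intro conjI allI impI)
  show "higher_point_derivation poly_algebra (\<lambda>p. poly p 1) taylor_functional"
    by (rule higher_point_derivation_taylor)
  show "\<exists>P. frechet_algebra A_D A_D_topology P"
    using D.frechet_algebra_completion by blast
  fix P assume P: "frechet_algebra A_D A_D_topology P"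
  have x: "D.seq_class log_seq \<in> disc_null_ideal"
    using log_seq_cauchy log_seq_null_disc_norm by (auto simp: disc_null_ideal_def)
  show "\<exists>x \<in> jacobson_radical A_D. quasinilpotent A_D P x \<and> \<not> nilpotent A_D x"
  proof (intro bexI conjI)
    show "quasinilpotent A_D P (D.seq_class log_seq)"
      using P disc_null_ideal_carrier[OF x] spectrum_disc_null_ideal[OF x] by (rule quasinilpotentI)
    show "D.seq_class log_seq \<in> jacobson_radical A_D"
      using disc_null_ideal_subset_jacobson_radical x by blast
  qed (rule log_seq_not_nilpotent)
qed

end
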